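(* Let $G$ be a finite abelian group of order $N$, let $S\subseteq G\setminus\{0\}$ satisfy $S=-S$, and let $K$ be a field with $\operatorname{char}(K)\nmid N$. For each $\mathcal{O}\in\mathcal{O}_K(G,S)$ put $M_{\mathcal{O}}=m_{G,S,K}/\Psi_{\mathcal{O},K}\in K[x]$. Then there exists $u_{\mathcal{O}}\in K[x]$ (computable by the extended Euclidean algorithm) with $M_{\mathcal{O}}u_{\mathcal{O}}\equiv 1\pmod{\Psi_{\mathcal{O},K}}$. Setting $e_{\mathcal{O}}=M_{\mathcal{O}}(A)u_{\mathcal{O}}(A)\in\mathcal{A}_K(\mathrm{Cay}(G,S))$, each $e_{\mathcal{O}}$ is a primitive idempotent of $\mathcal{A}_K(\mathrm{Cay}(G,S))$, and $$e_{\mathcal{O}}^2=e_{\mathcal{O}},\qquad e_{\mathcal{O}}e_{\mathcal{O}'}=0\ \text{ for }\mathcal{O}\neq\mathcal{O}',\qquad \sum_{\mathcal{O}\in\mathcal{O}_K(G,S)}e_{\mathcal{O}}=I.$$ Moreover, for each $\mathcal{O}$, $e_{\mathcal{O}}$ is the unique primitive idempotent $e$ of $\mathcal{A}_K(\mathrm{Cay}(G,S))$ with $e\,e_{\mathcal{O}'}=0$ for all $\mathcal{O}'\ne\mathcal{O}$ and $e+\sum_{\mathcal{O}'\neq\mathcal{O}}e_{\mathcal{O}'}=I$; and $e_{\mathcal{O}}\cdot\mathcal{A}_K(\mathrm{Cay}(G,S))\cong K[x]/(\Psi_{\mathcal{O},K})$ as $K$-algebras (where $e_{\mathcal{O}}$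 is the identity of the left-hand side).
   Context: $G$ is written additively. $\mathrm{Cay}(G,S)$ is the graph with vertex set $G$ and edges $\{g,g+s\}$ for $g\in G$, $s\in S$. Its adjacency matrix $A$, with rows and columns indexed by $G$, has $A_{g,h}=1$ if $h-g\in S$ and $A_{g,h}=0$ otherwise; it is regarded as a matrix over $K$. The spectral algebra is $\mathcal{A}_K(\mathrm{Cay}(G,S))=K[A]=\{f(A):f\in K[x]\}\subseteq M_N(K)$, and $m_{G,S,K}\in K[x]$ is the minimal polynomial of $A$ over $K$. $\overline{K}$ is an algebraic closure of $K$, $\widehat{G}=\mathrm{Hom}(G,\overline{K}^* )$, and $\lambda_\chi=\sum_{s\in S}\chi(s)\in\overline{K}$ for $\chi\in\widehat{G}$. $\mathcal{O}_K(G,S)$ is the partition of the set $\{\lambda_\chi:\chi\in\widehat{G}\}$ into orbits of $\mathrm{Gal}(\overline{K}/K)$ (the group of $K$-automorphisms of $\overline{K}$). For an orbit $\mathcal{O}$, $\Psi_{\mathcal{O},K}$ is the monic minimal polynomial over $K$ of any element of $\mathcal{O}$; each $\Psi_{\mathcal{O},K}$ divides $m_{G,S,K}$. *)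

theory Defs
  imports
    "HOL-Analysis.Finite_Cartesian_Product"
    "HOL-Number_Theory.Cong"
    "HOL-Algebra.QuotRing"
    "HOL-Algebra.Module"
    "HOL-Algebra.Algebraic_Closure_Type"
begin

text \<open>
  The group is a type \<open>'g\<close> of sort \<open>{finite, ab_group_add}\<close>, the field \<open>K\<close> is a type \<open>'k :: field\<close>,
  its algebraic closure is the library type \<open>'k alg_closure\<close> with the embedding \<^const>\<open>to_ac\<close>, and
  \<open>M\<^sub>N(K)\<close> is \<open>'k ^ 'g ^ 'g\<close> with product \<open>**\<close> and identity \<open>mat 1\<close>; \<open>mat c ** M\<close> is the scalar
  multiple of \<open>M\<close> by \<open>c\<close>.
\<close>

section \<open>Polynomials in a matrix, minimal polynomials\<close>

definition mat_power :: "'k::field ^ 'n ^ 'n \<Rightarrow> nat \<Rightarrow> 'k ^ 'n ^ 'n" where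
  "mat_power A i = (((**) A) ^^ i) (mat 1)"

definition poly_mat :: "'k::field poly \<Rightarrow> 'k ^ 'n ^ 'n \<Rightarrow> 'k ^ 'n ^ 'n" where
  "poly_mat f A = (\<Sum>i\<le>Polynomial.degree f. mat (Polynomial.coeff f i) ** mat_power A i)"

definition least_monic :: "('k::field poly \<Rightarrow> bool) \<Rightarrow> 'k poly" where
  "least_monic P = (THE p. Polynomial.lead_coeff p = 1 \<and> P p \<and>
     (\<forall>q. q \<noteq> 0 \<and> P q \<longrightarrow> Polynomial.degree p \<le> Polynomial.degree q))"

definition min_poly_mat :: "'k::field ^ 'n ^ 'n \<Rightarrow> 'k poly" where
  "min_poly_mat A = least_monic (\<lambda>p. poly_mat p A = 0)"

definition min_poly_ac :: "'k::field alg_closure \<Rightarrow> 'k poly" where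
  "min_poly_ac x = least_monic (\<lambda>p. poly (map_poly to_ac p) x = 0)"

section \<open>Algebras\<close>

definition primitive_idempotent :: "('a, 'm) ring_scheme \<Rightarrow> 'a \<Rightarrow> bool" where
  "primitive_idempotent R e \<longleftrightarrow>
     e \<in> carrier R \<and> e \<otimes>\<^bsub>R\<^esub> e = e \<and> e \<noteq> \<zero>\<^bsub>R\<^esub> \<and>
     (\<forall>a\<in>carrier R. \<forall>b\<in>carrier R.
        a \<otimes>\<^bsub>R\<^esub> a = a \<and> b \<otimes>\<^bsub>R\<^esub> b = b \<and> a \<otimes>\<^bsub>R\<^esub> b = \<zero>\<^bsub>R\<^esub> \<and> b \<otimes>\<^bsub>R\<^esub> a = \<zero>\<^bsub>R\<^esub> \<and> e = a \<oplus>\<^bsub>R\<^esub> b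
        \<longrightarrow> a = \<zero>\<^bsub>R\<^esub> \<or> b = \<zero>\<^bsub>R\<^esub>)"

definition component_algebra :: "('c, 'a) module \<Rightarrow> 'a \<Rightarrow> ('c, 'a) module" where
  "component_algebra R e = R\<lparr>carrier := {e \<otimes>\<^bsub>R\<^esub> a | a. a \<in> carrier R}, one := e\<rparr>"

definition algebra_isomorphic ::
    "'c ring \<Rightarrow> ('c, 'a) module \<Rightarrow> ('c, 'b) module \<Rightarrow> bool" where
  "algebra_isomorphic F A B \<longleftrightarrow>
     (\<exists>h \<in> ring_iso A B. \<forall>c\<in>carrier F. \<forall>x\<in>carrier A. h (c \<odot>\<^bsub>A\<^esub> x) = c \<odot>\<^bsub>B\<^esub> h x)"

text \<open>\<open>K[x]/(p)\<close>; the scalar \<open>c\<close> acts as multiplication by the class of the constant polynomial \<open>c\<close>.\<close>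

definition poly_quotient_algebra :: "'k::field poly \<Rightarrow> ('k, 'k poly set) module" where
  "poly_quotient_algebra p =
     (let P = ring_of_type_algebra; I = PIdl\<^bsub>P\<^esub> p; Q = P Quot I
      in \<lparr>carrier = carrier Q, monoid.mult = monoid.mult Q, one = monoid.one Q, ring.zero = ring.zero Q, add = add Q,
          module.smult = (\<lambda>c x. (I +>\<^bsub>P\<^esub> [:c:]) \<otimes>\<^bsub>Q\<^esub> x)\<rparr>)"

section \<open>Cayley graphs\<close>

definition cay_adj :: "'g::{finite, ab_group_add} set \<Rightarrow> 'k::field ^ ('g::_) ^ ('g::_)" where
  "cay_adj S = (\<chi> g h. if h - g \<in> S then 1 else 0)"

definition spectral_algebra :: "'k::field ^ 'n ^ 'n \<Rightarrow> ('k, 'k ^ 'n ^ 'n) module" where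
  "spectral_algebra A =
     \<lparr>carrier = {poly_mat f A | f. True}, monoid.mult = (**), one = mat 1, ring.zero = 0, add = (+),
      module.smult = (\<lambda>c M. mat c ** M)\<rparr>"

definition characters :: "('g::{finite, ab_group_add} \<Rightarrow> 'k::field alg_closure) set" where
  "characters = {\<psi>. (\<forall>g. \<psi> g \<noteq> 0) \<and> (\<forall>g h. \<psi> (g + h) = \<psi> g * \<psi> h)}"

definition cay_eigenvalue ::
    "'g::{finite, ab_group_add} set \<Rightarrow> ('g \<Rightarrow> 'k::field alg_closure) \<Rightarrow> 'k alg_closure" where
  "cay_eigenvalue S \<psi> = (\<Sum>s\<in>S. \<psi> s)"

definition galois_group :: "('k::field alg_closure \<Rightarrow> 'k alg_closure) set" where
  "galois_group = {\<sigma>. bij \<sigma> \<and> (\<forall>x y. \<sigma> (x + y) = \<sigma> x + \<sigma> y) \<and> (\<forall>x y. \<sigma> (x * y) = \<sigma> x * \<sigma> y) \<and>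
     (\<forall>a. \<sigma> (to_ac a) = to_ac a)}"

definition cay_orbits :: "'g::{finite, ab_group_add} set \<Rightarrow> 'k::field alg_closure set set" where
  "cay_orbits S = {{\<sigma> (cay_eigenvalue S \<psi>) | \<sigma>. \<sigma> \<in> galois_group} | \<psi>. \<psi> \<in> characters}"

text \<open>The common minimal polynomial of the elements of an orbit, see \<open>orbit_poly_eq\<close> below.\<close>

definition orbit_poly :: "'k::field alg_closure set \<Rightarrow> 'k poly" where
  "orbit_poly Q = (THE p. \<forall>x\<in>Q. p = min_poly_ac x)"

text \<open>The division is exact: every \<open>orbit_poly Q\<close> divides the minimal polynomial of the matrix.\<close>

definition cay_cofactor ::
    "'g::{finite, ab_group_add} set \<Rightarrow> 'k::field alg_closure set \<Rightarrow> 'k poly" where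
  "cay_cofactor S Q = min_poly_mat (cay_adj S) div orbit_poly Q"

section \<open>The extended Euclidean algorithm\<close>

text \<open>
  The library's \<^const>\<open>bezout_coefficients\<close> is not available for polynomials over an arbitrary
  type of sort \<open>field\<close>. The result \<open>(d, s, t)\<close> satisfies \<open>s * f + t * h = d\<close>,
  with \<open>d\<close> a greatest common divisor that need not be monic.
\<close>

function ext_euclid :: "'k::field poly \<Rightarrow> 'k poly \<Rightarrow> 'k poly \<times> 'k poly \<times> 'k poly" where
  "ext_euclid f h =
     (if h = 0 then (f, 1, 0)
      else let (d, s, t) = ext_euclid h (f mod h) in (d, t, s - f div h * t))"
  by auto
termination
  by (relation "measure (\<lambda>(f, h). euclidean_size h)") (simp_all add: mod_size_less)

declare ext_euclid.simps [simp del]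

text \<open>
  For coprime arguments the algorithm ends with a nonzero constant \<open>d\<close>, by which the
  coefficient of \<open>f\<close> is divided.
\<close>

definition euclid_inverse :: "'k::field poly \<Rightarrow> 'k poly \<Rightarrow> 'k poly" where
  "euclid_inverse f h = (case ext_euclid f h of (d, s, t) \<Rightarrow> s div d)"

section \<open>Well-definedness\<close>

lemma galois_poly:
  fixes p :: "'k::field poly"
  assumes "\<sigma> \<in> galois_group"
  shows "poly (map_poly to_ac p) (\<sigma> x) = \<sigma> (poly (map_poly to_ac p) x)"
proof -
  have \<sigma>: "\<sigma> (a + b) = \<sigma> a + \<sigma> b" "\<sigma> (a * b) = \<sigma> a * \<sigma> b" "\<sigma> (to_ac c) = to_ac c" for a b c
    using assms by (auto simp: galois_group_def)
  have "\<sigma> 0 = 0"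
    using \<sigma>(3)[of 0] by (simp only: to_ac_0)
  then show ?thesis
  proof (induction p)
    case (pCons a p)
    then show ?case
      by (simp add: map_poly_pCons \<sigma>)
  qed simp
qed

lemma min_poly_ac_galois:
  assumes "\<sigma> \<in> galois_group"
  shows "min_poly_ac (\<sigma> x) = min_poly_ac x"
proof -
  have \<sigma>: "inj \<sigma>" "\<sigma> (to_ac 0) = to_ac 0"
    using assms unfolding galois_group_def bij_def by blast+
  then have "\<sigma> y = 0 \<longleftrightarrow> y = 0" for y
    by (metis injD to_ac_0)
  then show ?thesis
    by (simp add: min_poly_ac_def galois_poly[OF assms])
qed

lemma orbit_poly_eq:
  assumes "Q \<in> cay_orbits S" "x \<in> Q"
  shows "orbit_poly Q = min_poly_ac x"
proof -
  obtain \<psi> where Q: "Q = {\<sigma> (cay_eigenvalue S \<psi>) | \<sigma>. \<sigma> \<in> galois_group}"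
    using assms(1) unfolding cay_orbits_def by blast
  have eq: "min_poly_ac y = min_poly_ac (cay_eigenvalue S \<psi>)" if y: "y \<in> Q" for y
  proof -
    obtain \<sigma> where "\<sigma> \<in> galois_group" "y = \<sigma> (cay_eigenvalue S \<psi>)"
      using y Q by blast
    then show ?thesis
      by (simp only: min_poly_ac_galois)
  qed
  show ?thesis
    unfolding orbit_poly_def
  proof (rule the_equality)
    show "\<forall>y\<in>Q. min_poly_ac x = min_poly_ac y"
      by (intro ballI) (simp only: eq[OF assms(2)] eq)
    show "p = min_poly_ac x" if "\<forall>y\<in>Q. p = min_poly_ac y" for p
      using that assms(2) by (rule bspec)
  qed
qed

end

theory Submission
  imports Defs
begin

text \<open>
  A matrix commuting with all translations of \<open>G\<close> is determined by its Fourier transform at the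
  characters, so \<open>f(A) = g(A)\<close> holds iff \<open>f\<close> and \<open>g\<close> agree at all eigenvalues \<open>\<lambda>\<^sub>\<chi>\<close>. Every claim
  about idempotents in \<open>K[A]\<close> then becomes a statement about the values of polynomials at the
  points of the orbits, where \<open>M\<^sub>O u\<^sub>O\<close> takes the value \<open>1\<close> on \<open>O\<close> and \<open>0\<close> on every other orbit.
  That distinct orbits have distinct minimal polynomials requires extending isomorphisms between
  subfields of the algebraic closure to automorphisms, by Zorn's lemma.
\<close>

section \<open>Minimal polynomials and Galois conjugates\<close>

text \<open>A polynomial over K that vanishes at one point of an orbit is divisible by the minimal
  polynomial of that point, hence vanishes on the whole orbit; so an element of K[A] can be tested
  at one point per orbit. A polynomial kills A as soon as it vanishes at every eigenvalue, so the
  minimal polynomial of A divides the product of the distinct \<open>orbit_poly Q\<close>, each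
  taken to the first power. This is why the cofactor of \<open>orbit_poly Q\<close> does not vanish
  on \<open>Q\<close> and is invertible modulo \<open>orbit_poly Q\<close>. The condition on the
  characteristic enters at one place: a character times its inverse sums to N over G, and N must be
  nonzero in K for the Fourier transform to be injective. Primitivity rests on the values lying in a
  field: of two orthogonal idempotents, one vanishes at a given point of the orbit and therefore on
  all of it.\<close>

definition ac_eval :: "'k::field poly \<Rightarrow> 'k alg_closure \<Rightarrow> 'k alg_closure" where
  "ac_eval f x = poly (map_poly to_ac f) x"

lemma ac_eval_0 [simp]: "ac_eval 0 x = 0"
  by (simp add: ac_eval_def)

lemma ac_eval_pCons [simp]: "ac_eval (pCons c f) x = to_ac c + x * ac_eval f x"
  by (simp add: ac_eval_def map_poly_pCons)

lemma ac_eval_1 [simp]: "ac_eval 1 x = 1"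
  by (simp add: one_pCons)

lemma ac_eval_add [simp]: "ac_eval (f + g) x = ac_eval f x + ac_eval g x"
  by (induction f g rule: poly_induct2) (simp_all add: algebra_simps)

lemma ac_eval_smult [simp]: "ac_eval (Polynomial.smult c f) x = to_ac c * ac_eval f x"
  by (induction f) (simp_all add: algebra_simps)

lemma ac_eval_minus [simp]: "ac_eval (- f) x = - ac_eval f x"
  by (induction f) (simp_all add: algebra_simps)

lemma ac_eval_diff [simp]: "ac_eval (f - g) x = ac_eval f x - ac_eval g x"
  using ac_eval_add[of f "- g" x] by (simp del: ac_eval_add)

lemma ac_eval_mult [simp]: "ac_eval (f * g) x = ac_eval f x * ac_eval g x"
  by (induction f) (simp_all add: algebra_simps)

lemma ac_eval_sum [simp]: "ac_eval (\<Sum>i\<in>I. f i) x = (\<Sum>i\<in>I. ac_eval (f i) x)"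
  by (induction I rule: infinite_finite_induct) simp_all

lemma ac_eval_prod [simp]: "ac_eval (\<Prod>i\<in>I. f i) x = (\<Prod>i\<in>I. ac_eval (f i) x)"
  by (induction I rule: infinite_finite_induct) simp_all

lemma ac_eval_altdef:
  "ac_eval f x = (\<Sum>i\<le>Polynomial.degree f. to_ac (Polynomial.coeff f i) * x ^ i)"
proof -
  have "Polynomial.degree (map_poly to_ac f) = Polynomial.degree f"
    by (rule degree_map_poly) simp_all
  then show ?thesis
    by (simp add: ac_eval_def poly_altdef coeff_map_poly)
qed

section \<open>Monic generators of ideals of K[x]\<close>

lemma monic_dvd_antisym:
  fixes p q :: "'k::field poly"
  assumes "p dvd q" "q dvd p" "Polynomial.lead_coeff p = 1" "Polynomial.lead_coeff q = 1"
  shows "p = q"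
proof -
  obtain k where k: "q = p * k"
    using assms(1) by (rule dvdE)
  with assms(4) have "Polynomial.lead_coeff k = 1"
    using assms(3) by (simp add: Polynomial.lead_coeff_mult)
  moreover have "k dvd 1"
  proof -
    obtain l where "p = q * l"
      using assms(2) by (rule dvdE)
    moreover have "p * (k * l) = q * l"
      by (simp only: k mult.assoc)
    ultimately have "p * (k * l) = p * 1"
      by (metis mult_1_right)
    moreover have "p \<noteq> 0"
      using assms(3) by auto
    ultimately have "k * l = 1"
      by (simp only: mult_cancel_left) blast
    then show ?thesis
      by (metis dvd_triv_left)
  qed
  then obtain c where "k = [:c:]"
    by (auto simp: is_unit_poly_iff)
  ultimately show ?thesis
    using k by simp
qed

text \<open>The assumptions make \<open>P\<close> a nonzero ideal of K[x]. Division with remainder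
  shows that any nonzero member of least degree divides every member, so the monic one is unique and
  the description by \<open>THE\<close> denotes the generator. Both kinds of minimal polynomial are
  instances.\<close>

lemma least_monic_dvd_iff:
  fixes P :: "'k::field poly \<Rightarrow> bool"
  assumes diff: "\<And>f g. P f \<Longrightarrow> P g \<Longrightarrow> P (f - g)"
    and mult: "\<And>f g. P f \<Longrightarrow> P (g * f)"
    and ex: "P f0" "f0 \<noteq> 0"
  shows "Polynomial.lead_coeff (least_monic P) = 1" "least_monic P dvd f \<longleftrightarrow> P f"
proof -
  obtain p0 where p0: "P p0" "p0 \<noteq> 0"
    and p0_min: "\<And>q. P q \<and> q \<noteq> 0 \<Longrightarrow> Polynomial.degree p0 \<le> Polynomial.degree q"
    using ex_has_least_nat[of "\<lambda>q. P q \<and> q \<noteq> 0" f0 Polynomial.degree] ex by auto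
  define p where "p = [:inverse (Polynomial.lead_coeff p0):] * p0"
  have p: "P p" "Polynomial.lead_coeff p = 1" "Polynomial.degree p = Polynomial.degree p0"
    unfolding p_def using p0 by (simp_all only: mult) simp_all
  have "p \<noteq> 0" using p(2) by auto
  have dvd: "r dvd f"
    if r: "P r" "r \<noteq> 0" "\<And>q. q \<noteq> 0 \<and> P q \<Longrightarrow> Polynomial.degree r \<le> Polynomial.degree q" and f: "P f"
    for r f
  proof (rule ccontr)
    assume "\<not> r dvd f"
    then have "f mod r \<noteq> 0" by (simp add: dvd_eq_mod_eq_0)
    moreover have "P (f mod r)"
      using diff[OF f mult[OF r(1), of "f div r"]] by (simp add: minus_div_mult_eq_mod)
    ultimately show False
      using r degree_mod_less[of r f] by fastforce
  qed
  have p_min: "\<And>q. q \<noteq> 0 \<and> P q \<Longrightarrow> Polynomial.degree p \<le> Polynomial.degree q"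
    using p0_min p by auto
  have "least_monic P = p"
    unfolding least_monic_def
  proof (rule the_equality)
    show "Polynomial.lead_coeff p = 1 \<and> P p \<and> (\<forall>q. q \<noteq> 0 \<and> P q \<longrightarrow> Polynomial.degree p \<le> Polynomial.degree q)"
      using p p_min by blast
    fix r assume r: "Polynomial.lead_coeff r = 1 \<and> P r \<and> (\<forall>q. q \<noteq> 0 \<and> P q \<longrightarrow> Polynomial.degree r \<le> Polynomial.degree q)"
    then have "r \<noteq> 0" by auto
    then show "r = p"
      using dvd[of p r] dvd[of r p] r p p_min \<open>p \<noteq> 0\<close>
      by (intro monic_dvd_antisym) auto
  qed
  then show "Polynomial.lead_coeff (least_monic P) = 1" "least_monic P dvd f \<longleftrightarrow> P f"
    using p p_min \<open>p \<noteq> 0\<close> dvd[of p f] mult[OF p(1)] by (auto simp: mult.commute elim!: dvdE)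
qed

lemma min_poly_ac_lead_coeff: "Polynomial.lead_coeff (min_poly_ac x) = 1"
  and min_poly_ac_dvd_iff: "min_poly_ac x dvd f \<longleftrightarrow> ac_eval f x = 0"
proof -
  obtain p where p: "p \<noteq> 0" "poly (map_poly to_ac p) x = 0"
    by (rule alg_closure_algebraic)
  have *: "min_poly_ac x = least_monic (\<lambda>p. ac_eval p x = 0)"
    by (simp add: min_poly_ac_def ac_eval_def)
  show "Polynomial.lead_coeff (min_poly_ac x) = 1" "min_poly_ac x dvd f \<longleftrightarrow> ac_eval f x = 0"
    unfolding * using p by (rule_tac least_monic_dvd_iff; simp add: ac_eval_def[symmetric])+
qed

text \<open>
  The graph of an isomorphism between two intermediate rings of \<open>'k alg_closure / 'k\<close>. As
  everything is algebraic over \<open>'k\<close>, single-valuedness already implies injectivity, so the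
  notion is symmetric under taking converses.
\<close>

definition partial_iso :: "('k::field alg_closure \<times> 'k alg_closure) set \<Rightarrow> bool" where
  "partial_iso F \<longleftrightarrow> (\<forall>c. (to_ac c, to_ac c) \<in> F) \<and>
     (\<forall>a b c d. (a, b) \<in> F \<longrightarrow> (c, d) \<in> F \<longrightarrow> (a + c, b + d) \<in> F \<and> (a * c, b * d) \<in> F) \<and>
     (\<forall>b. (0, b) \<in> F \<longrightarrow> b = 0)"

lemma partial_isoD:
  assumes "partial_iso F"
  shows "(to_ac c, to_ac c) \<in> F"
    and "(a, b) \<in> F \<Longrightarrow> (a', b') \<in> F \<Longrightarrow> (a + a', b + b') \<in> F"
    and "(a, b) \<in> F \<Longrightarrow> (a', b') \<in> F \<Longrightarrow> (a * a', b * b') \<in> F"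
    and "(0, b) \<in> F \<Longrightarrow> b = 0"
  using assms unfolding partial_iso_def by blast+

lemma partial_iso_0: "partial_iso F \<Longrightarrow> (0, 0) \<in> F"
  using partial_isoD(1)[of F 0] by simp

lemma partial_iso_1: "partial_iso F \<Longrightarrow> (1, 1) \<in> F"
  using partial_isoD(1)[of F 1] by simp

lemma partial_iso_diff:
  assumes "partial_iso F" "(a, b) \<in> F" "(a', b') \<in> F"
  shows "(a - a', b - b') \<in> F"
proof -
  have "(-1, -1) \<in> F"
    using partial_isoD(1)[OF assms(1), of "-1"] by simp
  from partial_isoD(3)[OF assms(1) this assms(3)] have "(- a', - b') \<in> F"
    by simp
  from partial_isoD(2)[OF assms(1,2) this] show ?thesis by simp
qed

lemma partial_iso_sum:
  assumes "partial_iso F" "\<And>i. i \<in> I \<Longrightarrow> (a i, b i) \<in> F"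
  shows "(\<Sum>i\<in>I. a i, \<Sum>i\<in>I. b i) \<in> F"
  using assms(2)
  by (induction I rule: infinite_finite_induct) (auto simp: partial_iso_0 assms(1) partial_isoD(2))

lemma partial_iso_single_valued:
  "partial_iso F \<Longrightarrow> (a, b) \<in> F \<Longrightarrow> (a, b') \<in> F \<Longrightarrow> b = b'"
  using partial_iso_diff[of F a b a b'] partial_isoD(4)[of F "b - b'"] by auto

text \<open>As \<open>a\<close> is nonzero, a factor X can be removed from an annihilating
  polynomial without losing the root \<open>a\<close>; this is repeated until the constant term is
  nonzero.\<close>

lemma annihilator_nonzero_constant_coeff:
  fixes a :: "'k::field alg_closure"
  assumes "a \<noteq> 0"
  shows "\<exists>p. ac_eval p a = 0 \<and> Polynomial.coeff p 0 \<noteq> 0"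
proof -
  have *: "p \<noteq> 0 \<Longrightarrow> ac_eval p a = 0 \<Longrightarrow> \<exists>q. ac_eval q a = 0 \<and> Polynomial.coeff q 0 \<noteq> 0" for p
  proof (induction p)
    case (pCons c p)
    show ?case
    proof (cases "c = 0")
      case True
      with pCons assms show ?thesis by auto
    next
      case False
      with pCons.prems show ?thesis by (intro exI[of _ "pCons c p"]) auto
    qed
  qed simp
  show ?thesis
    using * alg_closure_algebraic[of a] unfolding ac_eval_def by metis
qed

lemma partial_iso_ac_eval:
  assumes F: "partial_iso F" "(a, b) \<in> F"
  shows "(ac_eval p a, ac_eval p b) \<in> F"
  by (induction p) (auto intro!: partial_isoD partial_iso_0 F)

text \<open>Evaluating an annihilator of \<open>a\<close> at the pair \<open>(a, 0)\<close> gives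
  \<open>0\<close> on the left and the constant term on the right. With the constant term chosen
  nonzero, this contradicts single-valuedness at \<open>0\<close>.\<close>

lemma partial_iso_injective:
  assumes F: "partial_iso F" "(a, 0) \<in> F"
  shows "a = 0"
proof (rule ccontr)
  assume "a \<noteq> 0"
  then obtain p where p: "ac_eval p a = 0" "Polynomial.coeff p 0 \<noteq> 0"
    using annihilator_nonzero_constant_coeff by blast
  have "ac_eval p 0 = to_ac (Polynomial.coeff p 0)"
    by (cases p) simp
  with partial_iso_ac_eval[OF F, of p] p(1) have "to_ac (Polynomial.coeff p 0) = 0"
    by (intro partial_isoD(4)[OF F(1)]) simp
  with p(2) show False by simp
qed

lemma partial_iso_converse: "partial_iso F \<Longrightarrow> partial_iso (F\<inverse>)"
  using partial_iso_injective[of F] unfolding partial_iso_def[of "F\<inverse>"]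
  by (auto intro: partial_isoD)

section \<open>Extending a partial isomorphism by one element\<close>

definition poly_pair :: "('a::zero \<times> 'b::zero) set \<Rightarrow> 'a poly \<Rightarrow> 'b poly \<Rightarrow> bool" where
  "poly_pair F q q' \<longleftrightarrow> (\<forall>i. (Polynomial.coeff q i, Polynomial.coeff q' i) \<in> F)"

text \<open>The graph of the map that extends \<open>F\<close> to the ring generated by its domain
  and \<open>a\<close>, sending \<open>a\<close> to \<open>b\<close>. It is only a relation until
  \<open>b\<close> is known to be compatible with the algebraic relations satisfied by
  \<open>a\<close>.\<close>

definition adjoin_pair ::
    "('a::comm_ring_1 \<times> 'b::comm_ring_1) set \<Rightarrow> 'a \<Rightarrow> 'b \<Rightarrow> ('a \<times> 'b) set" where
  "adjoin_pair F a b = {(poly q a, poly q' b) | q q'. poly_pair F q q'}"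

lemma poly_pair_pCons_iff:
  "poly_pair F (pCons c q) (pCons c' q') \<longleftrightarrow> (c, c') \<in> F \<and> poly_pair F q q'"
  unfolding poly_pair_def by (auto simp: coeff_pCons split: nat.splits)

lemma poly_pair_0: "partial_iso F \<Longrightarrow> poly_pair F 0 0"
  by (simp add: poly_pair_def partial_iso_0)

lemma poly_pair_mult:
  assumes "partial_iso F" "poly_pair F p p'" "poly_pair F q q'"
  shows "poly_pair F (p * q) (p' * q')"
  using assms unfolding poly_pair_def coeff_mult
  by (auto intro!: partial_iso_sum partial_isoD(3))

text \<open>The assumption \<open>root\<close> is the well-definedness condition: every relation for
  \<open>a\<close> with coefficients in the domain of \<open>F\<close> is carried to a relation for
  \<open>b\<close>. It yields the clause of \<open>partial_iso\<close> about pairs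
  \<open>(0, b)\<close>; closure under the operations is polynomial arithmetic.\<close>

lemma adjoin_pair_partial_iso:
  assumes F: "partial_iso F"
    and root: "\<And>q q'. poly_pair F q q' \<Longrightarrow> poly q a = 0 \<Longrightarrow> poly q' b = 0"
  shows "partial_iso (adjoin_pair F a b)" "F \<subseteq> adjoin_pair F a b" "(a, b) \<in> adjoin_pair F a b"
proof -
  show sub: "F \<subseteq> adjoin_pair F a b"
  proof (rule subrelI)
    fix c d assume "(c, d) \<in> F"
    then have "poly_pair F [:c:] [:d:]"
      by (simp add: poly_pair_pCons_iff poly_pair_0 F)
    then have "(poly [:c:] a, poly [:d:] b) \<in> adjoin_pair F a b"
      unfolding adjoin_pair_def by blast
    then show "(c, d) \<in> adjoin_pair F a b"
      by simp
  qed
  have "poly_pair F [:0, 1:] [:0, 1:]"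
    by (simp add: poly_pair_pCons_iff poly_pair_0 partial_iso_0 partial_iso_1 F)
  then have "(poly [:0, 1:] a, poly [:0, 1:] b) \<in> adjoin_pair F a b"
    unfolding adjoin_pair_def by blast
  then show "(a, b) \<in> adjoin_pair F a b"
    by simp
  have add: "(x + x', y + y') \<in> adjoin_pair F a b" and mult: "(x * x', y * y') \<in> adjoin_pair F a b"
    if xy: "(x, y) \<in> adjoin_pair F a b" "(x', y') \<in> adjoin_pair F a b" for x y x' y'
  proof -
    obtain p p' q q' where pq: "poly_pair F p p'" "poly_pair F q q'"
      "x = poly p a" "y = poly p' b" "x' = poly q a" "y' = poly q' b"
      using xy unfolding adjoin_pair_def by auto
    have "poly_pair F (p + q) (p' + q')"
      using pq(1,2) by (auto simp: poly_pair_def intro: partial_isoD(2)[OF F])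
    then have "(poly (p + q) a, poly (p' + q') b) \<in> adjoin_pair F a b"
      unfolding adjoin_pair_def by blast
    then show "(x + x', y + y') \<in> adjoin_pair F a b"
      using pq by simp
    have "(poly (p * q) a, poly (p' * q') b) \<in> adjoin_pair F a b"
      using poly_pair_mult[OF F pq(1,2)] unfolding adjoin_pair_def by blast
    then show "(x * x', y * y') \<in> adjoin_pair F a b"
      using pq by simp
  qed
  have "y = 0" if "(0, y) \<in> adjoin_pair F a b" for y
    using that root unfolding adjoin_pair_def by auto
  with add mult sub show "partial_iso (adjoin_pair F a b)"
    unfolding partial_iso_def using partial_isoD(1)[OF F] by blast
qed

text \<open>
  The image of \<open>a\<close> is a root of the transport of a polynomial of least degree that annihilates \<open>a\<close>.
\<close>

lemma partial_iso_extend: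
  fixes a :: "'k::field alg_closure"
  assumes F: "partial_iso F"
  shows "\<exists>b. \<forall>q q'. poly_pair F q q' \<longrightarrow> poly q a = 0 \<longrightarrow> poly q' b = 0"
proof -
  have zero_iff: "c = 0 \<longleftrightarrow> c' = 0" if "(c, c') \<in> F" for c c'
    using that partial_iso_injective[OF F] partial_isoD(4)[OF F] by blast
  have coeff_0_iff: "Polynomial.coeff q i = 0 \<longleftrightarrow> Polynomial.coeff q' i = 0" if "poly_pair F q q'" for q q' i
    using that zero_iff unfolding poly_pair_def by blast
  have degree_eq: "Polynomial.degree q = Polynomial.degree q'" if "poly_pair F q q'" for q q'
    unfolding Polynomial.degree_def using coeff_0_iff[OF that] by simp
  have zero_poly_iff: "q = 0 \<longleftrightarrow> q' = 0" if "poly_pair F q q'" for q q'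
    using coeff_0_iff[OF that] by (simp add: poly_eq_iff)
  let ?ann = "\<lambda>p. p \<noteq> 0 \<and> (\<exists>p'. poly_pair F p p') \<and> poly p a = 0"
  obtain f where f: "f \<noteq> 0" "poly (map_poly to_ac f) a = 0"
    by (rule alg_closure_algebraic)
  have "poly_pair F (map_poly to_ac f) (map_poly to_ac f)"
    by (simp add: poly_pair_def coeff_map_poly partial_isoD(1)[OF F])
  moreover have "map_poly to_ac f \<noteq> 0"
    using f(1) by (simp add: map_poly_eq_0_iff)
  ultimately have "?ann (map_poly to_ac f)"
    using f(2) by blast
  from ex_has_least_nat[of ?ann, OF this, of Polynomial.degree]
  obtain p p' where p: "p \<noteq> 0" "poly_pair F p p'" "poly p a = 0"
    and p_min: "\<And>q q'. q \<noteq> 0 \<Longrightarrow> poly_pair F q q' \<Longrightarrow> poly q a = 0 \<Longrightarrow> Polynomial.degree p \<le> Polynomial.degree q"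
    by blast
  have "Polynomial.degree p \<noteq> 0"
  proof
    assume "Polynomial.degree p = 0"
    then obtain c where "p = [:c:]"
      by (rule degree_eq_zeroE)
    with p show False by simp
  qed
  then obtain b where b: "poly p' b = 0"
    using alg_closed_imp_poly_has_root[of p'] degree_eq[OF p(2)] by auto
  have "poly_pair F q q' \<Longrightarrow> poly q a = 0 \<Longrightarrow> poly q' b = 0" for q q'
  proof (induction "Polynomial.degree q" arbitrary: q q' rule: less_induct)
    case less
    show ?case
    proof (cases "q = 0")
      case True
      with zero_poly_iff[OF less.prems(1)] show ?thesis by simp
    next
      case False
      define d where "d = Polynomial.degree q - Polynomial.degree p"
      have d: "Polynomial.degree q = d + Polynomial.degree p"
        using p_min[OF False less.prems] unfolding d_def by simp
      let ?l = "Polynomial.lead_coeff p" and ?l' = "Polynomial.coeff p' (Polynomial.degree p)"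
      let ?m = "Polynomial.coeff q (Polynomial.degree q)" and ?m' = "Polynomial.coeff q' (Polynomial.degree q)"
      \<comment> \<open>Pseudo-division of \<open>q\<close> by \<open>p\<close>: nothing provides
        inverses in the domain of \<open>F\<close>, so \<open>q\<close> is scaled by the leading
        coefficient of \<open>p\<close> instead of \<open>p\<close> being made monic. The top terms
        cancel, and \<open>r'\<close> is built in parallel so that it stays the transport of
        \<open>r\<close>.\<close>
      define r where "r = Polynomial.smult ?l q - monom ?m d * p"
      define r' where "r' = Polynomial.smult ?l' q' - monom ?m' d * p'"
      have rF: "poly_pair F r r'"
        using p(2) less.prems(1) unfolding poly_pair_def r_def r'_def
        by (auto simp: coeff_monom_mult intro!: partial_iso_diff[OF F] partial_isoD(3)[OF F] partial_iso_0[OF F])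
      have ra: "poly r a = 0"
        by (simp add: r_def p less.prems)
      have "poly r' b = 0"
      proof (cases "r = 0")
        case True
        with zero_poly_iff[OF rF] show ?thesis by simp
      next
        case False
        have "Polynomial.degree r \<le> Polynomial.degree q"
          unfolding r_def using d
          by (intro degree_diff_le) (auto intro: order.trans[OF degree_mult_le] simp: degree_monom_le add_mono)
        moreover have "Polynomial.coeff r (Polynomial.degree q) = 0"
          by (simp add: r_def coeff_monom_mult d)
        then have "Polynomial.degree r \<noteq> Polynomial.degree q"
          using False by (metis leading_coeff_0_iff)
        ultimately show ?thesis
          using less.hyps[OF _ rF ra] by simp
      qed
      \<comment> \<open>From \<open>r'\<close> and \<open>p'\<close> vanishing at \<open>b\<close>,
        only \<open>?l'\<close> times the value of \<open>q'\<close> at \<open>b\<close> is known to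
        be zero; the factor has to be cancelled.\<close>
      moreover have "?l' \<noteq> 0"
        using coeff_0_iff[OF p(2)] p(1) by (metis leading_coeff_0_iff)
      ultimately show ?thesis
        using b by (simp add: r'_def)
    qed
  qed
  then show ?thesis by blast
qed

text \<open>A suitable image \<open>b\<close> always exists, and by maximality the extension by
  \<open>(a, b)\<close> is \<open>F\<close> itself.\<close>

lemma maximal_partial_iso_total:
  assumes F: "partial_iso F" and max: "\<And>F'. partial_iso F' \<Longrightarrow> F \<subseteq> F' \<Longrightarrow> F' = F"
  shows "\<exists>b. (a, b) \<in> F"
proof -
  obtain b where root: "\<And>q q'. poly_pair F q q' \<Longrightarrow> poly q a = 0 \<Longrightarrow> poly q' b = 0"
    using partial_iso_extend[OF F] by blast
  have "partial_iso (adjoin_pair F a b)" "F \<subseteq> adjoin_pair F a b" "(a, b) \<in> adjoin_pair F a b"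
    by (rule adjoin_pair_partial_iso[OF F root]; assumption)+
  with max show ?thesis by blast
qed

text \<open>The identity on K extends to a map sending \<open>x\<close> to \<open>y\<close>, and a
  maximal extension of that map is the graph of an automorphism.\<close>

lemma galois_conjugate:
  fixes x y :: "'k::field alg_closure"
  assumes "min_poly_ac x = min_poly_ac y"
  shows "\<exists>\<sigma>\<in>galois_group. \<sigma> x = y"
proof -
  define F0 :: "('k alg_closure \<times> 'k alg_closure) set" where "F0 = range (\<lambda>c. (to_ac c, to_ac c))"
  have F0: "partial_iso F0"
    unfolding partial_iso_def F0_def
    by (auto simp: image_iff simp flip: to_ac_add to_ac_mult)
  \<comment> \<open>Polynomials paired by \<open>F0\<close> are equal and have all coefficients in
    K, so the common minimal polynomial decides vanishing at both \<open>x\<close> and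
    \<open>y\<close>.\<close>
  have root: "poly q' y = 0" if "poly_pair F0 q q'" "poly q x = 0" for q q'
  proof -
    have "Polynomial.coeff q i = to_ac (of_ac (Polynomial.coeff q i))"
      "Polynomial.coeff q' i = Polynomial.coeff q i" for i
      using that(1) unfolding poly_pair_def F0_def by (auto simp: image_iff prod_eq_iff) (metis of_ac_to_ac)+
    then have "q' = q" "q = map_poly to_ac (map_poly of_ac q)"
      by (auto simp: poly_eq_iff coeff_map_poly)
    then obtain f where "q' = q" "q = map_poly to_ac f"
      by blast
    then show ?thesis
      using that(2) min_poly_ac_dvd_iff[of x f] min_poly_ac_dvd_iff[of y f] assms
      by (simp add: ac_eval_def)
  qed
  define F1 where "F1 = adjoin_pair F0 x y"
  have F1: "partial_iso F1" "(x, y) \<in> F1"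
    unfolding F1_def by (rule adjoin_pair_partial_iso[OF F0 root]; assumption)+
  have "\<exists>M\<in>{F. partial_iso F \<and> F1 \<subseteq> F}. \<forall>N\<in>{F. partial_iso F \<and> F1 \<subseteq> F}. M \<subseteq> N \<longrightarrow> N = M"
  proof (rule subset_Zorn_nonempty)
    show "{F. partial_iso F \<and> F1 \<subseteq> F} \<noteq> {}"
      using F1 by blast
    fix C assume C: "C \<noteq> {}" "subset.chain {F. partial_iso F \<and> F1 \<subseteq> F} C"
    have iso: "partial_iso F" "F1 \<subseteq> F" if "F \<in> C" for F
      using C that unfolding subset_chain_def by blast+
    have "(a + a', b + b') \<in> \<Union>C \<and> (a * a', b * b') \<in> \<Union>C"
      if ab: "(a, b) \<in> \<Union>C" "(a', b') \<in> \<Union>C" for a b a' b'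
    proof -
      obtain F F' where "F \<in> C" "(a, b) \<in> F" "F' \<in> C" "(a', b') \<in> F'"
        using ab by blast
      moreover from this C(2) have "F \<subseteq> F' \<or> F' \<subseteq> F"
        unfolding subset_chain_def by blast
      ultimately obtain F where F: "F \<in> C" "(a, b) \<in> F" "(a', b') \<in> F"
        by blast
      show ?thesis
        using partial_isoD(2,3)[OF iso(1)[OF F(1)] F(2,3)] F(1) by blast
    qed
    moreover have "(to_ac c, to_ac c) \<in> \<Union>C" for c
      using C(1) iso partial_isoD(1) by blast
    moreover have "b = 0" if "(0, b) \<in> \<Union>C" for b
      using that iso partial_isoD(4) by blast
    ultimately have "partial_iso (\<Union>C)"
      unfolding partial_iso_def by blast
    then show "\<Union>C \<in> {F. partial_iso F \<and> F1 \<subseteq> F}"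
      using C(1) iso by blast
  qed
  then obtain M where M: "partial_iso M" "F1 \<subseteq> M"
    and M_max: "\<And>N. partial_iso N \<Longrightarrow> M \<subseteq> N \<Longrightarrow> N = M"
    by auto
  \<comment> \<open>The converse of \<open>M\<close> is maximal too, so totality of the converse
    gives surjectivity of \<open>M\<close>.\<close>
  have "N = M\<inverse>" if "partial_iso N" "M\<inverse> \<subseteq> N" for N
  proof -
    have "M \<subseteq> N\<inverse>"
      using that(2) by auto
    from M_max[OF partial_iso_converse[OF that(1)] this] show ?thesis
      by (rule subst[of _ M]) simp
  qed
  then have surj: "\<exists>a. (a, b) \<in> M" for b
    using maximal_partial_iso_total[OF partial_iso_converse[OF M(1)], of b] by blast
  define \<sigma> where "\<sigma> a = (SOME b. (a, b) \<in> M)" for a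
  have in_M: "(a, \<sigma> a) \<in> M" for a
    unfolding \<sigma>_def using maximal_partial_iso_total[OF M(1) M_max] by (rule someI_ex)
  have eqI: "\<sigma> a = b" if "(a, b) \<in> M" for a b
    using partial_iso_single_valued[OF M(1) in_M that] .
  have "inj \<sigma>"
    using partial_iso_single_valued[OF partial_iso_converse[OF M(1)]] in_M
    by (metis converse_iff injI)
  moreover have "surj \<sigma>"
    using surj eqI by (metis surjI)
  ultimately have "\<sigma> \<in> galois_group"
    using eqI in_M partial_isoD[OF M(1)] unfolding galois_group_def bij_def by auto
  moreover have "\<sigma> x = y"
    using eqI F1(2) M(2) by blast
  ultimately show ?thesis by blast
qed

section \<open>Characters and translation-invariant matrices\<close>

text \<open>This is p(T) applied to \<open>w\<close>, where T is the translation operator taking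
  \<open>w\<close> to the function with value \<open>w (g + h)\<close> at \<open>h\<close>. It makes
  the functions on G a module over the polynomial ring, one such structure for each
  \<open>g\<close>.\<close>

definition shift_act :: "'l::comm_ring_1 poly \<Rightarrow> 'g::ab_group_add \<Rightarrow> ('g \<Rightarrow> 'l) \<Rightarrow> 'g \<Rightarrow> 'l" where
  "shift_act p g w = fold_coeffs (\<lambda>a v h. a * w h + v (g + h)) p (\<lambda>_. 0)"

lemma shift_act_0 [simp]: "shift_act 0 g w h = 0"
  by (simp add: shift_act_def)

lemma shift_act_pCons [simp]: "shift_act (pCons a p) g w h = a * w h + shift_act p g w (g + h)"
  by (cases "p = 0 \<and> a = 0") (auto simp: shift_act_def)

lemma shift_act_add: "shift_act (p + q) g w h = shift_act p g w h + shift_act q g w h"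
  by (induction p q arbitrary: h rule: poly_induct2) (simp_all add: algebra_simps)

lemma shift_act_smult: "shift_act (Polynomial.smult a p) g w h = a * shift_act p g w h"
  by (induction p arbitrary: h) (simp_all add: algebra_simps)

lemma shift_act_monom: "shift_act (monom a n) g w h = a * w (((+) g ^^ n) h)"
  by (induction n arbitrary: h) (simp_all add: monom_0 monom_Suc funpow_swap1)

text \<open>Pigeonhole on the multiples of \<open>g\<close>; agreement at \<open>0\<close> suffices
  because the iterates are translations.\<close>

lemma funpow_plus_collision:
  fixes g :: "'g::{finite, ab_group_add}"
  shows "\<exists>i j. i < j \<and> (\<forall>h. ((+) g ^^ i) h = ((+) g ^^ j) h)"
proof -
  have "\<not> inj (\<lambda>i. ((+) g ^^ i) 0)"
    using finite_imageD[of "\<lambda>i. ((+) g ^^ i) 0" "UNIV :: nat set"] by auto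
  then obtain i j where ij: "i < j" "((+) g ^^ i) 0 = ((+) g ^^ j) 0"
    unfolding inj_def by (metis linorder_neqE_nat)
  have "((+) g ^^ n) h = ((+) g ^^ n) 0 + h" for n h
    by (induction n) (simp_all add: add.assoc)
  with ij show ?thesis by metis
qed

lemma shift_act_annihilator:
  fixes g :: "'g::{finite, ab_group_add}"
  shows "\<exists>p. p \<noteq> 0 \<and> (\<forall>w h. shift_act (p :: 'l::comm_ring_1 poly) g w h = 0)"
proof -
  obtain i j where ij: "i < j" "\<And>h. ((+) g ^^ i) h = ((+) g ^^ j) h"
    using funpow_plus_collision[of g] by blast
  let ?p = "monom 1 j + monom (- 1) i :: 'l poly"
  have "Polynomial.coeff ?p j \<noteq> 0"
    using ij(1) by simp
  then have "?p \<noteq> 0" by (metis coeff_0)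
  moreover have "shift_act ?p g w h = 0" for w h
    by (simp add: shift_act_add shift_act_monom ij(2))
  ultimately show ?thesis by blast
qed

locale translation_submodule =
  fixes W :: "('g::{finite, ab_group_add} \<Rightarrow> 'l::alg_closed_field) set"
  assumes zero: "(\<lambda>_. 0) \<in> W"
    and add: "v \<in> W \<Longrightarrow> w \<in> W \<Longrightarrow> (\<lambda>h. v h + w h) \<in> W"
    and scale: "v \<in> W \<Longrightarrow> (\<lambda>h. a * v h) \<in> W"
    and translate: "v \<in> W \<Longrightarrow> (\<lambda>h. v (k + h)) \<in> W"
begin

lemma shift_act_closed: "w \<in> W \<Longrightarrow> shift_act p g w \<in> W"
proof (induction p)
  case 0
  show ?case
    using zero by (simp add: shift_act_def)
next
  case (pCons a p)
  then have "(\<lambda>h. a * w h + shift_act p g w (g + h)) \<in> W"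
    by (intro add scale translate)
  also have "(\<lambda>h. a * w h + shift_act p g w (g + h)) = shift_act (pCons a p) g w"
    by (rule ext) simp
  finally show ?case .
qed

text \<open>The elements of \<open>B\<close> are treated one at a time. If \<open>p\<close> is a
  least annihilator of \<open>w\<close> under translation by \<open>g\<close> and \<open>p\<close>
  is X - z times \<open>q\<close>, then \<open>q\<close> applied to \<open>w\<close> is a nonzero
  eigenvector for \<open>g\<close> with eigenvalue z. It remains an eigenvector for the earlier
  elements because translations commute.\<close>

lemma eigenvector_of_set:
  assumes "v \<in> W" "v \<noteq> (\<lambda>_. 0)" "finite B"
  shows "\<exists>w\<in>W. w \<noteq> (\<lambda>_. 0) \<and> (\<forall>g\<in>B. \<exists>z. \<forall>h. w (g + h) = z * w h)"
  using assms(3)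
proof (induction B rule: finite_induct)
  case empty
  with assms show ?case by auto
next
  case (insert g B)
  then obtain w where w: "w \<in> W" "w \<noteq> (\<lambda>_. 0)" "\<And>k. k \<in> B \<Longrightarrow> \<exists>z. \<forall>h. w (k + h) = z * w h"
    by blast
  let ?ann = "\<lambda>p. p \<noteq> 0 \<and> (\<forall>h. shift_act p g w h = 0)"
  obtain p0 where "?ann p0"
    using shift_act_annihilator[of g] by blast
  from ex_has_least_nat[of ?ann, OF this, of Polynomial.degree]
  obtain p where p: "?ann p" and p_min: "\<And>q. ?ann q \<Longrightarrow> Polynomial.degree p \<le> Polynomial.degree q"
    by blast
  have "Polynomial.degree p \<noteq> 0"
  proof
    assume "Polynomial.degree p = 0"
    then obtain c where "p = [:c:]"
      by (rule degree_eq_zeroE)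
    with p w(2) show False by auto
  qed
  then obtain z where "poly p z = 0"
    using alg_closed_imp_poly_has_root by blast
  then obtain q where q: "p = [:- z, 1:] * q"
    by (auto simp: poly_eq_0_iff_dvd)
  with p have "q \<noteq> 0" by auto
  then have "Polynomial.degree q < Polynomial.degree p"
    unfolding q by (subst degree_mult_eq) auto
  \<comment> \<open>Having smaller degree than the least annihilator, \<open>q\<close> cannot kill
    \<open>w\<close>.\<close>
  with p_min \<open>q \<noteq> 0\<close> have nz: "shift_act q g w \<noteq> (\<lambda>_. 0)"
    by (metis not_le)
  have "shift_act q g w (g + h) = z * shift_act q g w h" for h
  proof -
    have "p = pCons 0 q + Polynomial.smult (- z) q"
      by (simp add: q)
    then have "shift_act p g w h = shift_act q g w (g + h) - z * shift_act q g w h"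
      by (simp only: shift_act_add shift_act_smult shift_act_pCons) simp
    with p show ?thesis by simp
  qed
  moreover have "\<exists>z. \<forall>h. shift_act q g w (k + h) = z * shift_act q g w h" if "k \<in> B" for k
  proof -
    obtain y where y: "\<And>h. w (k + h) = y * w h"
      using w(3)[OF \<open>k \<in> B\<close>] by blast
    have "shift_act q g w (k + h) = y * shift_act q g w h" for h
    proof (induction q arbitrary: h)
      case (pCons a q)
      have "g + (k + h) = k + (g + h)" by (simp add: algebra_simps)
      then show ?case
        by (simp only: shift_act_pCons y pCons.IH) (simp add: algebra_simps)
    qed simp
    then show ?thesis by blast
  qed
  ultimately show ?case
    using shift_act_closed[OF w(1)] nz by blast
qed

end

lemma characterD:
  assumes "\<psi> \<in> characters"
  shows "\<psi> g \<noteq> 0" "\<psi> (g + h) = \<psi> g * \<psi> h" "\<psi> 0 = 1"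
proof -
  show *: "\<psi> g \<noteq> 0" "\<psi> (g + h) = \<psi> g * \<psi> h" for g h
    using assms by (auto simp: characters_def)
  show "\<psi> 0 = 1"
    using *(2)[of 0 0] *(1)[of 0] by simp
qed

text \<open>
  Otherwise the functions orthogonal to all characters contain a common eigenvector of the
  translations, which is a multiple of a character and hence not orthogonal to its inverse.
\<close>

lemma characters_separate:
  fixes c :: "'g::{finite, ab_group_add} \<Rightarrow> 'k::field alg_closure"
  assumes char: "\<not> CHAR('k) dvd CARD('g)"
    and orth: "\<And>\<psi>. \<psi> \<in> characters \<Longrightarrow> (\<Sum>g\<in>UNIV. c g * \<psi> g) = 0"
  shows "c = (\<lambda>_. 0)"
proof (rule ccontr)
  assume "c \<noteq> (\<lambda>_. 0)"
  define W :: "('g \<Rightarrow> 'k alg_closure) set"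
    where "W = {w. \<forall>\<psi>\<in>characters. (\<Sum>g\<in>UNIV. w g * \<psi> g) = 0}"
  interpret translation_submodule W
  proof
    \<comment> \<open>Translating \<open>v\<close> by \<open>k\<close> multiplies its pairing with a
      character by the value of that character at \<open>- k\<close>.\<close>
    fix v and k :: 'g assume v: "v \<in> W"
    have "(\<Sum>g\<in>UNIV. v (k + g) * \<psi> g) = 0" if \<psi>: "\<psi> \<in> characters" for \<psi>
    proof -
      have "(\<Sum>g\<in>UNIV. v (k + g) * \<psi> g) = (\<Sum>g\<in>UNIV. v g * \<psi> (g - k))"
        by (rule sum.reindex_bij_witness[of _ "\<lambda>g. g - k" "\<lambda>g. k + g"]) (simp_all add: algebra_simps)
      also have "\<dots> = (\<Sum>g\<in>UNIV. v g * \<psi> g) * \<psi> (- k)"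
        using characterD(2)[OF \<psi>, of _ "- k"] by (simp add: sum_distrib_right mult.assoc)
      finally show ?thesis
        using v \<psi> by (simp add: W_def)
    qed
    then show "(\<lambda>h. v (k + h)) \<in> W"
      by (simp add: W_def)
  qed (auto simp: W_def algebra_simps sum.distrib simp flip: sum_distrib_left)
  have "c \<in> W"
    using orth by (simp add: W_def)
  from eigenvector_of_set[OF this \<open>c \<noteq> (\<lambda>_. 0)\<close>, of UNIV]
  obtain w where w: "w \<in> W" "w \<noteq> (\<lambda>_. 0)" "\<forall>g. \<exists>z. \<forall>h. w (g + h) = z * w h"
    by auto
  then obtain z where z: "\<And>g h. w (g + h) = z g * w h"
    by metis
  have w_eq: "w g = z g * w 0" for g
    using z[of g 0] by simp
  with w(2) have w0: "w 0 \<noteq> 0"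
    by (metis mult_zero_right)
  \<comment> \<open>The eigenvalues form the character: \<open>w\<close> is \<open>z\<close> times
    the nonzero constant \<open>w 0\<close>, which can be cancelled.\<close>
  have z_add: "z (g + h) = z g * z h" for g h
  proof -
    have "z (g + h) * w 0 = z g * (z h * w 0)"
      using z[of g "h + 0"] z[of h 0] w_eq[of "g + h"] by simp
    with w0 show ?thesis by simp
  qed
  have "z 0 = 1"
    using w_eq[of 0] w0 by simp
  then have z_inv: "z g * z (- g) = 1" for g
    using z_add[of g "- g"] by simp
  have "z g \<noteq> 0" for g
    using z_inv[of g] by auto
  then have "(\<lambda>g. z (- g)) \<in> characters"
    by (simp add: characters_def z_add algebra_simps flip: z_add)
  then have "0 = (\<Sum>g\<in>UNIV. w g * z (- g))"
    using w(1) by (simp add: W_def)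
  also have "\<dots> = (\<Sum>g\<in>UNIV. w 0 * (z g * z (- g)))"
    by (subst w_eq) (simp add: algebra_simps)
  \<comment> \<open>Each summand equals \<open>w 0\<close>, so orthogonality would force N to be
    zero in K.\<close>
  also have "\<dots> = of_nat CARD('g) * w 0"
    by (simp add: z_inv)
  finally have "of_nat CARD('g) = (0 :: 'k alg_closure)"
    using w0 by simp
  with char show False
    by (simp add: of_nat_eq_0_iff_char_dvd)
qed

text \<open>Two coinciding iterates of translation by \<open>g\<close> force every value at
  \<open>g\<close> to be a root of X^j - X^i, which leaves finitely many choices for each group
  element.\<close>

lemma finite_characters: "finite (characters :: ('g::{finite, ab_group_add} \<Rightarrow> 'k::field alg_closure) set)"
proof -
  have "\<exists>B :: 'k alg_closure set. finite B \<and> (\<forall>\<psi>\<in>characters. \<psi> g \<in> B)" for g :: 'g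
  proof -
    obtain i j where ij: "i < j" "\<And>h. ((+) g ^^ i) h = ((+) g ^^ j) h"
      using funpow_plus_collision[of g] by blast
    let ?p = "monom 1 j - monom 1 i :: 'k alg_closure poly"
    have "Polynomial.coeff ?p j \<noteq> 0"
      using ij(1) by simp
    then have "?p \<noteq> 0" by (metis coeff_0)
    then have "finite {x. poly ?p x = 0}"
      by (rule poly_roots_finite)
    moreover have "poly ?p (\<psi> g) = 0" if \<psi>: "\<psi> \<in> characters" for \<psi>
    proof -
      have "\<psi> (((+) g ^^ n) 0) = \<psi> g ^ n" for n
        by (induction n) (simp_all add: characterD[OF \<psi>])
      with ij(2)[of 0] show ?thesis
        by (simp add: poly_monom) metis
    qed
    ultimately show ?thesis
      by (intro exI[of _ "{x. poly ?p x = 0}"]) simp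
  qed
  then have "\<exists>B :: 'g \<Rightarrow> 'k alg_closure set. \<forall>g. finite (B g) \<and> (\<forall>\<psi>\<in>characters. \<psi> g \<in> B g)"
    by (intro choice) blast
  then obtain B :: "'g \<Rightarrow> 'k alg_closure set"
    where B: "\<And>g. finite (B g)" "\<And>g \<psi>. \<psi> \<in> characters \<Longrightarrow> \<psi> g \<in> B g"
    by blast
  have "characters \<subseteq> (\<Pi>\<^sub>E g\<in>UNIV. B g)"
    using B(2) by auto
  moreover have "finite (\<Pi>\<^sub>E g\<in>UNIV. B g)"
    using B(1) by (intro finite_PiE) auto
  ultimately show ?thesis
    by (rule finite_subset)
qed

section \<open>Fourier transform of translation-invariant matrices\<close>

definition translation_invariant :: "'k ^ ('g::{finite, ab_group_add}) ^ ('g::_) \<Rightarrow> bool" where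
  "translation_invariant M \<longleftrightarrow> (\<forall>g h. M $ g $ h = M $ 0 $ (h - g))"

text \<open>For a translation-invariant \<open>M\<close> the first row determines the matrix, and
  this sum is the eigenvalue of \<open>M\<close> on the vector given by the character.\<close>

definition fourier ::
    "'k::field ^ ('g::{finite, ab_group_add}) ^ ('g::_) \<Rightarrow> ('g \<Rightarrow> 'k alg_closure) \<Rightarrow> 'k alg_closure" where
  "fourier M \<psi> = (\<Sum>h\<in>UNIV. to_ac (M $ 0 $ h) * \<psi> h)"

lemma translation_invariantD: "translation_invariant M \<Longrightarrow> M $ g $ h = M $ 0 $ (h - g)"
  unfolding translation_invariant_def by blast

lemma translation_invariant_mat: "translation_invariant (mat c)"
  by (auto simp: translation_invariant_def mat_def)

lemma translation_invariant_0: "translation_invariant 0"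
  by (simp add: translation_invariant_def)

lemma translation_invariant_add:
  "translation_invariant M \<Longrightarrow> translation_invariant N \<Longrightarrow> translation_invariant (M + N)"
  unfolding translation_invariant_def by (metis vector_add_component)

lemma translation_invariant_sum:
  "(\<And>i. i \<in> I \<Longrightarrow> translation_invariant (M i)) \<Longrightarrow> translation_invariant (\<Sum>i\<in>I. M i)"
  by (induction I rule: infinite_finite_induct)
    (auto simp: translation_invariant_add translation_invariant_0)

lemma translation_invariant_mult:
  fixes M N :: "'k::field ^ ('g::{finite, ab_group_add}) ^ ('g::_)"
  assumes "translation_invariant M" "translation_invariant N"
  shows "translation_invariant (M ** N)"
proof -
  have "(\<Sum>k\<in>UNIV. M $ g $ k * N $ k $ h) = (\<Sum>k\<in>UNIV. M $ 0 $ k * N $ k $ (h - g))" for g h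
  proof (rule sum.reindex_bij_witness[of _ "\<lambda>k. g + k" "\<lambda>k. k - g"])
    fix k
    have "N $ (k - g) $ (h - g) = N $ k $ h"
      using translation_invariantD[OF assms(2), of "k - g" "h - g"] translation_invariantD[OF assms(2), of k h]
      by simp
    then show "M $ 0 $ (k - g) * N $ (k - g) $ (h - g) = M $ g $ k * N $ k $ h"
      using translation_invariantD[OF assms(1), of g k] by simp
  qed simp_all
  then show ?thesis
    by (simp add: translation_invariant_def matrix_matrix_mult_def)
qed

lemma fourier_0 [simp]: "fourier 0 \<psi> = 0"
  by (simp add: fourier_def)

lemma fourier_add [simp]: "fourier (M + N) \<psi> = fourier M \<psi> + fourier N \<psi>"
  by (simp add: fourier_def algebra_simps sum.distrib)

lemma fourier_sum [simp]: "fourier (\<Sum>i\<in>I. M i) \<psi> = (\<Sum>i\<in>I. fourier (M i) \<psi>)"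
  by (induction I rule: infinite_finite_induct) simp_all

lemma fourier_mat: "\<psi> \<in> characters \<Longrightarrow> fourier (mat c) \<psi> = to_ac c"
  by (simp add: fourier_def mat_def if_distrib[of to_ac] if_distrib[of "\<lambda>x. x * _"] characterD(3) cong: if_cong)

text \<open>Convolution theorem: invariance of \<open>N\<close> turns the row at \<open>0\<close> of
  the product into a convolution, and the shift of \<open>h\<close> by \<open>k\<close> splits the
  character.\<close>

lemma fourier_mult:
  assumes \<psi>: "\<psi> \<in> characters" and N: "translation_invariant N"
  shows "fourier (M ** N) \<psi> = fourier M \<psi> * fourier N \<psi>"
proof -
  have "fourier (M ** N) \<psi> = (\<Sum>h\<in>UNIV. \<Sum>k\<in>UNIV. to_ac (M $ 0 $ k) * to_ac (N $ 0 $ (h - k)) * \<psi> h)"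
    by (simp add: fourier_def matrix_matrix_mult_def to_ac_sum sum_distrib_right
        flip: translation_invariantD[OF N])
  also have "\<dots> = (\<Sum>k\<in>UNIV. \<Sum>h\<in>UNIV. to_ac (M $ 0 $ k) * to_ac (N $ 0 $ (h - k)) * \<psi> h)"
    by (rule sum.swap)
  also have "\<dots> = (\<Sum>k\<in>UNIV. \<Sum>h\<in>UNIV. (to_ac (M $ 0 $ k) * \<psi> k) * (to_ac (N $ 0 $ h) * \<psi> h))"
  proof (rule sum.cong[OF refl])
    fix k
    show "(\<Sum>h\<in>UNIV. to_ac (M $ 0 $ k) * to_ac (N $ 0 $ (h - k)) * \<psi> h) =
        (\<Sum>h\<in>UNIV. (to_ac (M $ 0 $ k) * \<psi> k) * (to_ac (N $ 0 $ h) * \<psi> h))"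
      by (rule sum.reindex_bij_witness[of _ "\<lambda>h. k + h" "\<lambda>h. h - k"])
        (simp_all add: characterD(2)[OF \<psi>, symmetric] mult.assoc mult.left_commute)
  qed
  also have "\<dots> = fourier M \<psi> * fourier N \<psi>"
    by (simp add: fourier_def sum_product)
  finally show ?thesis .
qed

lemma fourier_eq_iff:
  fixes M N :: "'k::field ^ ('g::{finite, ab_group_add}) ^ ('g::_)"
  assumes char: "\<not> CHAR('k) dvd CARD('g)"
    and inv: "translation_invariant M" "translation_invariant N"
  shows "M = N \<longleftrightarrow> (\<forall>\<psi>\<in>characters. fourier M \<psi> = fourier N \<psi>)"
proof
  assume eq: "\<forall>\<psi>\<in>characters. fourier M \<psi> = fourier N \<psi>"
  have "(\<lambda>g. to_ac (M $ 0 $ g - N $ 0 $ g)) = (\<lambda>_. 0)"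
    using eq by (intro characters_separate[OF char]) (simp add: fourier_def algebra_simps sum_subtractf)
  then have "M $ 0 $ g = N $ 0 $ g" for g
    by (metis (mono_tags) eq_iff_diff_eq_0 to_ac_eq_0_iff)
  then show "M = N"
    using translation_invariantD[OF inv(1)] translation_invariantD[OF inv(2)] by (metis vec_eq_iff)
qed simp

lemma mat_power_translation_invariant:
  "translation_invariant A \<Longrightarrow> translation_invariant (mat_power A i)"
  unfolding mat_power_def
  by (induction i) (simp_all add: translation_invariant_mat translation_invariant_mult)

lemma poly_mat_translation_invariant:
  "translation_invariant A \<Longrightarrow> translation_invariant (poly_mat f A)"
  unfolding poly_mat_def
  by (intro translation_invariant_sum translation_invariant_mult translation_invariant_mat
      mat_power_translation_invariant)

lemma fourier_mat_power:
  assumes "\<psi> \<in> characters" "translation_invariant A"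
  shows "fourier (mat_power A i) \<psi> = fourier A \<psi> ^ i"
proof (induction i)
  case 0
  show ?case
    by (simp add: mat_power_def fourier_mat[OF assms(1)])
next
  case (Suc i)
  have "mat_power A (Suc i) = A ** mat_power A i"
    by (simp add: mat_power_def)
  with Suc show ?case
    by (simp add: fourier_mult assms mat_power_translation_invariant)
qed

lemma fourier_poly_mat:
  assumes "\<psi> \<in> characters" "translation_invariant A"
  shows "fourier (poly_mat f A) \<psi> = ac_eval f (fourier A \<psi>)"
  by (simp add: poly_mat_def ac_eval_altdef fourier_mult fourier_mat fourier_mat_power assms
      mat_power_translation_invariant)

lemma cay_adj_translation_invariant: "translation_invariant (cay_adj S)"
  by (simp add: translation_invariant_def cay_adj_def)

lemma fourier_cay_adj: "fourier (cay_adj S) \<psi> = cay_eigenvalue S \<psi>"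
proof -
  have "fourier (cay_adj S) \<psi> = (\<Sum>h\<in>UNIV. if h \<in> S then \<psi> h else 0)"
    unfolding fourier_def by (rule sum.cong) (simp_all add: cay_adj_def)
  then show ?thesis
    by (simp add: cay_eigenvalue_def sum.If_cases)
qed

section \<open>Orbits of eigenvalues\<close>

lemma id_galois_group: "(\<lambda>x. x) \<in> galois_group"
  by (simp add: galois_group_def bij_id[unfolded id_def])

lemma comp_galois_group: "\<sigma> \<in> galois_group \<Longrightarrow> \<tau> \<in> galois_group \<Longrightarrow> \<sigma> \<circ> \<tau> \<in> galois_group"
  unfolding galois_group_def by (auto simp: bij_comp)

definition galois_orbit :: "'k::field alg_closure \<Rightarrow> 'k alg_closure set" where
  "galois_orbit x = {\<sigma> x | \<sigma>. \<sigma> \<in> galois_group}"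

lemma galois_orbit_eqI:
  assumes "min_poly_ac x = min_poly_ac y"
  shows "galois_orbit x = galois_orbit y"
proof -
  have "galois_orbit x \<subseteq> galois_orbit y" if eq: "min_poly_ac x = min_poly_ac y"
    for x y :: "'a alg_closure"
  proof
    fix z assume "z \<in> galois_orbit x"
    then obtain \<sigma> where \<sigma>: "\<sigma> \<in> galois_group" "z = \<sigma> x"
      unfolding galois_orbit_def by blast
    obtain \<tau> where \<tau>: "\<tau> \<in> galois_group" "\<tau> y = x"
      using galois_conjugate[OF eq[symmetric]] by blast
    have "z = (\<sigma> \<circ> \<tau>) y"
      using \<sigma> \<tau> by simp
    with comp_galois_group[OF \<sigma>(1) \<tau>(1)] show "z \<in> galois_orbit y"
      unfolding galois_orbit_def by blast
  qed
  with assms show ?thesis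
    by (metis subset_antisym)
qed

lemma cay_orbits_altdef: "cay_orbits S = (\<lambda>\<psi>. galois_orbit (cay_eigenvalue S \<psi>)) ` characters"
  unfolding cay_orbits_def galois_orbit_def by blast

lemma finite_cay_orbits: "finite (cay_orbits S)"
  unfolding cay_orbits_altdef by (intro finite_imageI finite_characters)

lemma cay_orbit_memberE:
  assumes "Q \<in> cay_orbits S"
  obtains \<psi> where "\<psi> \<in> characters" "cay_eigenvalue S \<psi> \<in> Q" "Q = galois_orbit (cay_eigenvalue S \<psi>)"
proof -
  obtain \<psi> where \<psi>: "\<psi> \<in> characters" "Q = galois_orbit (cay_eigenvalue S \<psi>)"
    using assms unfolding cay_orbits_altdef by blast
  moreover have "cay_eigenvalue S \<psi> \<in> Q"
    unfolding \<psi>(2) galois_orbit_def using id_galois_group by force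
  ultimately show ?thesis
    using that by blast
qed

lemma cay_eigenvalue_in_orbit:
  assumes "\<psi> \<in> characters"
  shows "\<exists>Q\<in>cay_orbits S. cay_eigenvalue S \<psi> \<in> Q"
proof
  show "galois_orbit (cay_eigenvalue S \<psi>) \<in> cay_orbits S"
    unfolding cay_orbits_altdef using assms by blast
  show "cay_eigenvalue S \<psi> \<in> galois_orbit (cay_eigenvalue S \<psi>)"
    unfolding galois_orbit_def using id_galois_group by force
qed

lemma orbit_poly_lead_coeff:
  "Q \<in> cay_orbits S \<Longrightarrow> Polynomial.lead_coeff (orbit_poly Q) = 1"
  by (metis cay_orbit_memberE orbit_poly_eq min_poly_ac_lead_coeff)

text \<open>The left-hand side does not mention \<open>x\<close>, so vanishing passes from one point
  of an orbit to all others.\<close>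

lemma orbit_poly_dvd_iff:
  "Q \<in> cay_orbits S \<Longrightarrow> x \<in> Q \<Longrightarrow> orbit_poly Q dvd f \<longleftrightarrow> ac_eval f x = 0"
  by (simp add: orbit_poly_eq min_poly_ac_dvd_iff)

lemma ac_eval_orbit_poly_self:
  "Q \<in> cay_orbits S \<Longrightarrow> x \<in> Q \<Longrightarrow> ac_eval (orbit_poly Q) x = 0"
  using orbit_poly_dvd_iff[of Q S x "orbit_poly Q"] by simp

text \<open>Monic irreducible polynomials with a common root coincide, and then the orbits coincide
  by \<open>galois_orbit_eqI\<close>. Irreducibility appears here as primality, tested at a root in
  the closure.\<close>

lemma ac_eval_orbit_poly_other:
  assumes Q: "Q \<in> cay_orbits S" and Q': "Q' \<in> cay_orbits S" "x \<in> Q'" and "Q \<noteq> Q'"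
  shows "ac_eval (orbit_poly Q) x \<noteq> 0"
proof
  assume "ac_eval (orbit_poly Q) x = 0"
  then have dvd: "orbit_poly Q' dvd orbit_poly Q"
    using orbit_poly_dvd_iff[OF Q'] by blast
  then obtain k where k: "orbit_poly Q = orbit_poly Q' * k"
    by (rule dvdE)
  obtain \<psi> where \<psi>: "cay_eigenvalue S \<psi> \<in> Q" "Q = galois_orbit (cay_eigenvalue S \<psi>)"
    using Q by (rule cay_orbit_memberE)
  obtain \<psi>' where \<psi>': "cay_eigenvalue S \<psi>' \<in> Q'" "Q' = galois_orbit (cay_eigenvalue S \<psi>')"
    using Q'(1) by (rule cay_orbit_memberE)
  have "ac_eval (orbit_poly Q') (cay_eigenvalue S \<psi>) = 0 \<or> ac_eval k (cay_eigenvalue S \<psi>) = 0"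
    using ac_eval_orbit_poly_self[OF Q \<psi>(1)] k by simp
  then have "orbit_poly Q dvd orbit_poly Q' \<or> orbit_poly Q dvd k"
    using orbit_poly_dvd_iff[OF Q \<psi>(1)] by blast
  then show False
  proof
    assume "orbit_poly Q dvd orbit_poly Q'"
    with dvd have "orbit_poly Q = orbit_poly Q'"
      by (intro monic_dvd_antisym) (auto simp: orbit_poly_lead_coeff[OF Q] orbit_poly_lead_coeff[OF Q'(1)])
    then have "min_poly_ac (cay_eigenvalue S \<psi>) = min_poly_ac (cay_eigenvalue S \<psi>')"
      using orbit_poly_eq[OF Q \<psi>(1)] orbit_poly_eq[OF Q'(1) \<psi>'(1)] by simp
    with \<psi>(2) \<psi>'(2) \<open>Q \<noteq> Q'\<close> galois_orbit_eqI show False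
      by blast
  next
    \<comment> \<open>In this case \<open>orbit_poly Q'\<close> would be a unit, although it has the
      root \<open>x\<close>.\<close>
    assume "orbit_poly Q dvd k"
    then obtain l where "k = orbit_poly Q * l"
      by (rule dvdE)
    with k have "orbit_poly Q * (orbit_poly Q' * l) = orbit_poly Q * 1"
      by (simp add: algebra_simps)
    moreover have "orbit_poly Q \<noteq> 0"
      using orbit_poly_lead_coeff[OF Q] by auto
    ultimately have "orbit_poly Q' * l = 1"
      by (simp only: mult_cancel_left) blast
    then have "ac_eval (orbit_poly Q' * l) x = 1"
      by simp
    with ac_eval_orbit_poly_self[OF Q'] show False
      by simp
  qed
qed

lemma poly_mat_cay_eq_iff:
  fixes S :: "'g::{finite, ab_group_add} set" and f g :: "'k::field poly"
  assumes "\<not> CHAR('k) dvd CARD('g)"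
  shows "poly_mat f (cay_adj S :: 'k ^ ('g::_) ^ ('g::_)) = poly_mat g (cay_adj S) \<longleftrightarrow>
    (\<forall>Q\<in>cay_orbits S. \<forall>x\<in>Q. ac_eval f x = ac_eval g x)"
proof -
  have "poly_mat f (cay_adj S :: 'k ^ ('g::_) ^ ('g::_)) = poly_mat g (cay_adj S) \<longleftrightarrow>
      (\<forall>\<psi>\<in>characters. ac_eval f (cay_eigenvalue S \<psi>) = ac_eval g (cay_eigenvalue S \<psi>))"
    by (subst fourier_eq_iff[OF assms])
      (simp_all add: poly_mat_translation_invariant cay_adj_translation_invariant fourier_poly_mat
        fourier_cay_adj)
  also have "\<dots> \<longleftrightarrow> (\<forall>Q\<in>cay_orbits S. \<forall>x\<in>Q. ac_eval f x = ac_eval g x)"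
  proof
    assume eq: "\<forall>\<psi>\<in>characters. ac_eval f (cay_eigenvalue S \<psi>) = ac_eval g (cay_eigenvalue S \<psi>)"
    show "\<forall>Q\<in>cay_orbits S. \<forall>x\<in>Q. ac_eval f x = ac_eval g x"
    proof (intro ballI)
      \<comment> \<open>Agreement is known only at the eigenvalue that generates the orbit;
        divisibility of \<open>f - g\<close> by the orbit polynomial carries it to
        \<open>x\<close>.\<close>
      fix Q and x :: "'k alg_closure" assume Q: "Q \<in> cay_orbits S" "x \<in> Q"
      obtain \<psi> where "\<psi> \<in> characters" "cay_eigenvalue S \<psi> \<in> Q"
        using Q(1) by (rule cay_orbit_memberE)
      then show "ac_eval f x = ac_eval g x"
        using eq orbit_poly_dvd_iff[OF Q, of "f - g"] orbit_poly_dvd_iff[OF Q(1), of _ "f - g"] by auto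
    qed
  qed (use cay_eigenvalue_in_orbit in blast)
  finally show ?thesis .
qed

section \<open>Correctness of the extended Euclidean algorithm\<close>

lemma ext_euclid_correct:
  assumes "ext_euclid f h = (d, s, t)"
  shows "s * f + t * h = d \<and> d dvd f \<and> d dvd h"
  using assms
proof (induction f h arbitrary: d s t rule: ext_euclid.induct)
  case (1 f h)
  show ?case
  proof (cases "h = 0")
    case True
    with 1(2) show ?thesis
      by (auto simp: ext_euclid.simps[of f 0])
  next
    case False
    obtain d' s' t' where rec: "ext_euclid h (f mod h) = (d', s', t')"
      by (metis prod_cases3)
    then have eq: "d = d'" "s = t'" "t = s' - f div h * t'"
      using 1(2) False by (auto simp: ext_euclid.simps[of f h])
    have IH: "s' * h + t' * (f mod h) = d' \<and> d' dvd h \<and> d' dvd f mod h"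
      using 1(1)[OF False rec] .
    have "s * f + t * h = s' * h + t' * (f - f div h * h)"
      unfolding eq by (simp add: algebra_simps)
    also have "f - f div h * h = f mod h"
      by (rule minus_div_mult_eq_mod)
    finally show ?thesis
      using IH eq(1) dvd_mod_iff[of d' h f] by auto
  qed
qed

text \<open>The computed divisor \<open>d\<close> divides \<open>f\<close>, so it is nonzero at
  \<open>x\<close>; hence its cofactor in \<open>orbit_poly Q\<close> vanishes at \<open>x\<close>
  and is a multiple of \<open>orbit_poly Q\<close>. So \<open>d\<close> is a nonzero constant, and
  dividing the Bezout identity by it gives the inverse.\<close>

lemma euclid_inverse_cong:
  assumes Q: "Q \<in> cay_orbits S" "x \<in> Q" and f: "ac_eval f x \<noteq> 0"
  shows "[f * euclid_inverse f (orbit_poly Q) = 1] (mod orbit_poly Q)"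
proof -
  obtain d s t where dst: "ext_euclid f (orbit_poly Q) = (d, s, t)"
    by (metis prod_cases3)
  have bezout: "s * f + t * orbit_poly Q = d" and dvd: "d dvd f" "d dvd orbit_poly Q"
    using ext_euclid_correct[OF dst] by auto
  obtain k where k: "orbit_poly Q = d * k"
    using dvd(2) by (rule dvdE)
  have "ac_eval d x \<noteq> 0"
    using dvd(1) f by (auto elim!: dvdE)
  then have "ac_eval k x = 0"
    using ac_eval_orbit_poly_self[OF Q] k by simp
  then obtain l where "k = orbit_poly Q * l"
    using orbit_poly_dvd_iff[OF Q] by (auto elim!: dvdE)
  with k have "orbit_poly Q * (d * l) = orbit_poly Q * 1"
    by (simp add: algebra_simps)
  moreover have "orbit_poly Q \<noteq> 0"
    using orbit_poly_lead_coeff[OF Q(1)] by auto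
  ultimately have "d * l = 1"
    by (simp only: mult_cancel_left) blast
  then have "d dvd 1"
    by (metis dvd_triv_left)
  then obtain c where c: "d = [:c:]"
    by (auto simp: is_unit_poly_iff)
  with \<open>ac_eval d x \<noteq> 0\<close> have "c \<noteq> 0"
    by auto
  have "euclid_inverse f (orbit_poly Q) = Polynomial.smult (inverse c) s"
    using div_smult_right[of s c 1] by (simp add: euclid_inverse_def dst c)
  moreover have "f * Polynomial.smult (inverse c) s - 1 = - Polynomial.smult (inverse c) t * orbit_poly Q"
  proof -
    have "f * Polynomial.smult (inverse c) s + Polynomial.smult (inverse c) t * orbit_poly Q
        = Polynomial.smult (inverse c) (s * f + t * orbit_poly Q)"
      by (simp add: smult_add_right algebra_simps)
    also have "\<dots> = 1"
      unfolding bezout c using \<open>c \<noteq> 0\<close> by (simp add: one_pCons)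
    finally show ?thesis
      by (simp add: algebra_simps eq_diff_eq)
  qed
  ultimately show ?thesis
    by (metis cong_iff_dvd_diff dvd_triv_right)
qed

section \<open>Primitive idempotents\<close>

lemma poly_mat_0: "poly_mat 0 A = 0"
  by (simp add: poly_mat_def vec_eq_iff matrix_matrix_mult_def mat_def)

text \<open>The parameter \<open>K\<close> carries no data; it fixes the coefficient field, which
  the type of \<open>S\<close> does not mention.\<close>

locale cayley_spectrum =
  fixes S :: "'g::{finite, ab_group_add} set" and K :: "'k::field itself"
  assumes char: "\<not> CHAR('k) dvd CARD('g)"
begin

abbreviation A :: "'k ^ ('g::_) ^ ('g::_)" where
  "A \<equiv> cay_adj S"

abbreviation orbits :: "'k alg_closure set set" where
  "orbits \<equiv> cay_orbits S"

lemmas poly_mat_eq_iff = poly_mat_cay_eq_iff[OF char]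

text \<open>Identities in K[A] are checked at the characters, where they become identities of values
  in a field. That \<open>poly_mat\<close> respects the ring operations follows this way, without
  expanding coefficients.\<close>

lemma matrix_eqI:
  fixes M N :: "'k ^ ('g::_) ^ ('g::_)"
  assumes "translation_invariant M" "translation_invariant N"
    and "\<And>\<psi>. \<psi> \<in> characters \<Longrightarrow> fourier M \<psi> = fourier N \<psi>"
  shows "M = N"
  using assms fourier_eq_iff[OF char] by blast

lemmas invariance_rules =
  cay_adj_translation_invariant poly_mat_translation_invariant translation_invariant_mult
  translation_invariant_add translation_invariant_mat translation_invariant_sum

lemmas fourier_rules = fourier_mult fourier_mat fourier_poly_mat

lemma poly_mat_mult: "poly_mat f A ** poly_mat g A = poly_mat (f * g) A"
  by (rule matrix_eqI) (simp_all add: invariance_rules fourier_rules)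

lemma poly_mat_add: "poly_mat f A + poly_mat g A = poly_mat (f + g) A"
  by (rule matrix_eqI) (simp_all add: invariance_rules fourier_rules)

lemma poly_mat_smult: "mat c ** poly_mat f A = poly_mat ([:c:] * f) A"
  by (rule matrix_eqI) (simp_all add: invariance_rules fourier_rules)

lemma poly_mat_1: "poly_mat 1 A = mat 1"
  by (rule matrix_eqI) (simp_all add: invariance_rules fourier_rules)

lemma poly_mat_sum: "(\<Sum>i\<in>I. poly_mat (f i) A) = poly_mat (\<Sum>i\<in>I. f i) A"
  by (rule matrix_eqI) (simp_all add: invariance_rules fourier_rules)

lemma poly_mat_eq_0_iff: "poly_mat f A = 0 \<longleftrightarrow> (\<forall>Q\<in>orbits. \<forall>x\<in>Q. ac_eval f x = 0)"
  using poly_mat_eq_iff[of f S 0] by (simp add: poly_mat_0)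

lemma orbit_poly_nonzero: "Q \<in> orbits \<Longrightarrow> orbit_poly Q \<noteq> 0"
  using orbit_poly_lead_coeff[of Q S] by auto

lemma orbit_nonempty: "Q \<in> orbits \<Longrightarrow> \<exists>x. x \<in> Q"
  by (meson cay_orbit_memberE)

lemma min_poly_mat_dvd_iff:
  "min_poly_mat A dvd f \<longleftrightarrow> (\<forall>Q\<in>orbits. \<forall>x\<in>Q. ac_eval f x = 0)"
proof -
  \<comment> \<open>The product of all orbit polynomials is a nonzero annihilator of
    \<open>A\<close>, so the ideal has a monic generator.\<close>
  let ?P = "\<lambda>p. poly_mat p A = 0" and ?f0 = "\<Prod>Q\<in>orbits. orbit_poly Q"
  have "?P ?f0"
    by (auto simp: poly_mat_eq_0_iff finite_cay_orbits intro: ac_eval_orbit_poly_self)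
  moreover have "?f0 \<noteq> 0"
    using orbit_poly_nonzero by (simp add: finite_cay_orbits)
  ultimately have "least_monic ?P dvd f \<longleftrightarrow> ?P f"
    by (rule_tac least_monic_dvd_iff(2); simp add: poly_mat_eq_0_iff)
  then show ?thesis
    by (simp add: min_poly_mat_def poly_mat_eq_0_iff)
qed

lemma ac_eval_min_poly_mat: "Q \<in> orbits \<Longrightarrow> x \<in> Q \<Longrightarrow> ac_eval (min_poly_mat A) x = 0"
  using min_poly_mat_dvd_iff[of "min_poly_mat A"] by simp

lemma orbit_poly_mult_cofactor:
  assumes "Q \<in> orbits"
  shows "orbit_poly Q * cay_cofactor S Q = min_poly_mat A"
proof -
  obtain x where x: "x \<in> Q"
    using orbit_nonempty[OF assms] by blast
  have "orbit_poly Q dvd min_poly_mat A"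
    unfolding orbit_poly_dvd_iff[OF assms x] using assms x by (rule ac_eval_min_poly_mat)
  then show ?thesis
    by (simp add: cay_cofactor_def)
qed

lemma ac_eval_cofactor_other:
  assumes "Q \<in> orbits" "Q' \<in> orbits" "x \<in> Q'" "Q \<noteq> Q'"
  shows "ac_eval (cay_cofactor S Q) x = 0"
proof -
  have "ac_eval (min_poly_mat A) x = 0"
    using assms(2,3) by (rule ac_eval_min_poly_mat)
  then have "ac_eval (orbit_poly Q) x * ac_eval (cay_cofactor S Q) x = 0"
    by (simp flip: orbit_poly_mult_cofactor[OF assms(1)])
  then show ?thesis
    using ac_eval_orbit_poly_other[OF assms] by simp
qed

text \<open>The product of all orbit polynomials is a multiple of the minimal polynomial of
  \<open>A\<close>. Cancelling \<open>orbit_poly Q\<close> shows that the cofactor divides the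
  product over the other orbits, which is nonzero at \<open>x\<close>.\<close>

lemma ac_eval_cofactor_self:
  assumes Q: "Q \<in> orbits" "x \<in> Q"
  shows "ac_eval (cay_cofactor S Q) x \<noteq> 0"
proof -
  let ?g = "\<Prod>Q'\<in>orbits - {Q}. orbit_poly Q'"
  have "ac_eval (orbit_poly Q * ?g) y = 0" if "Q' \<in> orbits" "y \<in> Q'" for Q' y
    using that ac_eval_orbit_poly_self[OF that]
    by (cases "Q' = Q") (auto simp: finite_cay_orbits)
  then have "orbit_poly Q * cay_cofactor S Q dvd orbit_poly Q * ?g"
    unfolding orbit_poly_mult_cofactor[OF Q(1)] min_poly_mat_dvd_iff by blast
  then have "cay_cofactor S Q dvd ?g"
    using orbit_poly_nonzero[OF Q(1)] by simp
  then obtain k where k: "?g = cay_cofactor S Q * k"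
    by (rule dvdE)
  have "ac_eval ?g x \<noteq> 0"
    using Q ac_eval_orbit_poly_other[OF _ Q] by (auto simp: finite_cay_orbits)
  then show ?thesis
    unfolding k by simp
qed

lemma euclid_inverse_cofactor_cong:
  assumes "Q \<in> orbits"
  shows "[cay_cofactor S Q * euclid_inverse (cay_cofactor S Q) (orbit_poly Q) = 1] (mod orbit_poly Q)"
proof -
  obtain x where "x \<in> Q"
    using orbit_nonempty[OF assms] by blast
  then show ?thesis
    using euclid_inverse_cong[OF assms] ac_eval_cofactor_self[OF assms] by blast
qed

end

section \<open>The idempotents and their components\<close>

lemma poly_ring_coset:
  "PIdl\<^bsub>ring_of_type_algebra\<^esub> p +>\<^bsub>ring_of_type_algebra\<^esub> f = {g. p dvd g - (f :: 'k::field poly)}"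
proof (rule subset_antisym; rule subsetI)
  fix g assume "g \<in> {g. p dvd g - f}"
  then obtain k where "g - f = p * k"
    by (auto elim: dvdE)
  then have "g = k * p + f"
    by (simp add: algebra_simps)
  then show "g \<in> PIdl\<^bsub>ring_of_type_algebra\<^esub> p +>\<^bsub>ring_of_type_algebra\<^esub> f"
    by (auto simp: a_r_coset_def' cgenideal_def ring_of_type_algebra_def)
qed (auto simp: a_r_coset_def' cgenideal_def ring_of_type_algebra_def)

text \<open>Any choice of inverses \<open>u\<close> is allowed. The values of the resulting
  polynomials on the orbits do not depend on it, so neither do the matrices.\<close>

locale cayley_idempotents = cayley_spectrum S K
    for S :: "'g::{finite, ab_group_add} set" and K :: "'k::field itself" +
  fixes u :: "'k alg_closure set \<Rightarrow> 'k poly"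
  assumes cong: "Q \<in> orbits \<Longrightarrow> [cay_cofactor S Q * u Q = 1] (mod orbit_poly Q)"
begin

definition idem_poly :: "'k alg_closure set \<Rightarrow> 'k poly" where
  "idem_poly Q = cay_cofactor S Q * u Q"

definition e :: "'k alg_closure set \<Rightarrow> 'k ^ ('g::_) ^ ('g::_)" where
  "e Q = poly_mat (idem_poly Q) A"

lemma e_altdef: "poly_mat (cay_cofactor S Q) A ** poly_mat (u Q) A = e Q"
  by (simp add: e_def idem_poly_def poly_mat_mult)

lemma ac_eval_idem_poly:
  assumes "Q \<in> orbits" "Q' \<in> orbits" "x \<in> Q'"
  shows "ac_eval (idem_poly Q) x = (if Q = Q' then 1 else 0)"
proof (cases "Q = Q'")
  case True
  have "orbit_poly Q dvd idem_poly Q - 1"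
    using cong[OF assms(1)] by (simp add: cong_iff_dvd_diff idem_poly_def)
  then have "ac_eval (idem_poly Q - 1) x = 0"
    using orbit_poly_dvd_iff assms True by blast
  with True show ?thesis by simp
next
  case False
  with ac_eval_cofactor_other[OF assms] show ?thesis
    by (simp add: idem_poly_def)
qed

lemma e_idem: "Q \<in> orbits \<Longrightarrow> e Q ** e Q = e Q"
  unfolding e_def poly_mat_mult poly_mat_eq_iff by (simp add: ac_eval_idem_poly)

lemma e_orth: "Q \<in> orbits \<Longrightarrow> Q' \<in> orbits \<Longrightarrow> Q \<noteq> Q' \<Longrightarrow> e Q ** e Q' = 0"
  unfolding e_def poly_mat_mult poly_mat_eq_0_iff by (simp add: ac_eval_idem_poly)

lemma e_sum: "(\<Sum>Q\<in>orbits. e Q) = mat 1"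
  unfolding e_def poly_mat_sum poly_mat_1[symmetric] poly_mat_eq_iff
  by (auto simp: ac_eval_idem_poly finite_cay_orbits)

lemma e_add_sum: "Q \<in> orbits \<Longrightarrow> e Q + (\<Sum>Q'\<in>orbits - {Q}. e Q') = mat 1"
  using e_sum by (simp add: sum.remove finite_cay_orbits)

text \<open>Let \<open>e Q\<close> be a sum of orthogonal idempotents. On \<open>Q\<close> their
  product is zero, so one of them vanishes at \<open>x\<close> and hence on all of \<open>Q\<close>.
  On every other orbit sum and product are both zero, so it vanishes there too.\<close>

lemma e_primitive:
  assumes Q: "Q \<in> orbits"
  shows "primitive_idempotent (spectral_algebra A) (e Q)"
proof -
  obtain x where x: "x \<in> Q"
    using orbit_nonempty[OF Q] by blast
  have "ac_eval (idem_poly Q) x = 1"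
    using ac_eval_idem_poly[OF Q Q x] by simp
  with Q x have "e Q \<noteq> 0"
    unfolding e_def by (metis poly_mat_eq_0_iff zero_neq_one)
  moreover have "poly_mat f A = 0 \<or> poly_mat g A = 0"
    if idem: "poly_mat f A ** poly_mat f A = poly_mat f A" "poly_mat g A ** poly_mat g A = poly_mat g A"
      and orth: "poly_mat f A ** poly_mat g A = 0" and sum: "e Q = poly_mat f A + poly_mat g A" for f g
  proof -
    \<comment> \<open>Stated for fresh \<open>f\<close> and \<open>g\<close>, so that it serves for
      either summand.\<close>
    have vanish: "poly_mat f A = 0"
      if idem: "poly_mat f A ** poly_mat f A = poly_mat f A"
        and orth: "poly_mat f A ** poly_mat g A = 0" and sum: "e Q = poly_mat f A + poly_mat g A"
        and f: "ac_eval f x = 0" for f g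
      unfolding poly_mat_eq_0_iff
    proof (intro ballI)
      fix Q' y assume Q': "Q' \<in> orbits" "y \<in> Q'"
      show "ac_eval f y = 0"
      proof (cases "Q = Q'")
        case True
        with f show ?thesis
          using orbit_poly_dvd_iff[OF Q x] orbit_poly_dvd_iff[OF Q'] by blast
      next
        case False
        have "ac_eval f y * ac_eval f y = ac_eval f y" "ac_eval f y * ac_eval g y = 0"
          using idem orth Q' unfolding poly_mat_mult poly_mat_eq_iff poly_mat_eq_0_iff by auto
        moreover have "ac_eval f y + ac_eval g y = 0"
          using sum Q' ac_eval_idem_poly[OF Q Q'] False
          unfolding e_def poly_mat_add poly_mat_eq_iff by auto
        ultimately show ?thesis
          by (metis add.right_neutral mult_eq_0_iff)
      qed
    qed
    have "ac_eval f x * ac_eval g x = 0"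
      using orth Q x unfolding poly_mat_mult poly_mat_eq_0_iff by auto
    moreover have "poly_mat g A ** poly_mat f A = 0" "e Q = poly_mat g A + poly_mat f A"
      using orth sum by (simp_all add: poly_mat_mult mult.commute add.commute)
    ultimately show ?thesis
      using vanish[OF idem(1) orth sum] vanish[OF idem(2)] by auto
  qed
  ultimately show ?thesis
    using e_idem[OF Q] unfolding primitive_idempotent_def spectral_algebra_def
    by (auto simp: e_def)
qed

text \<open>On other orbits both sides vanish; on \<open>Q\<close> the factor \<open>e Q\<close> has
  value 1. So the map sending \<open>f\<close> to \<open>e Q ** poly_mat f A\<close> has the ideal
  generated by \<open>orbit_poly Q\<close> as its kernel.\<close>

lemma e_mult_eq_iff:
  assumes Q: "Q \<in> orbits"
  shows "e Q ** poly_mat f A = e Q ** poly_mat g A \<longleftrightarrow> orbit_poly Q dvd f - g"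
proof -
  obtain x where x: "x \<in> Q"
    using orbit_nonempty[OF Q] by blast
  have "e Q ** poly_mat f A = e Q ** poly_mat g A \<longleftrightarrow> (\<forall>y\<in>Q. ac_eval f y = ac_eval g y)"
    using Q unfolding e_def poly_mat_mult poly_mat_eq_iff by (auto simp: ac_eval_idem_poly)
  also have "\<dots> \<longleftrightarrow> (\<forall>y\<in>Q. orbit_poly Q dvd f - g)"
    by (simp add: orbit_poly_dvd_iff[OF Q])
  finally show ?thesis
    using x by blast
qed

lemma e_component_iso:
  assumes Q: "Q \<in> orbits"
  shows "algebra_isomorphic ring_of_type_algebra
    (component_algebra (spectral_algebra A) (e Q)) (poly_quotient_algebra (orbit_poly Q))"
proof -
  define P :: "'k poly ring" where "P = ring_of_type_algebra"
  define I where "I = PIdl\<^bsub>P\<^esub> (orbit_poly Q)"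
  let ?C = "component_algebra (spectral_algebra A) (e Q)" and ?B = "poly_quotient_algebra (orbit_poly Q)"
  define v where "v f = e Q ** poly_mat f A" for f
  \<comment> \<open>The inverse of the map induced by \<open>v\<close> on the quotient: an element
    of the component is sent to the set of all polynomials representing it, which is a coset of
    \<open>I\<close>. No representative has to be chosen.\<close>
  define h where "h y = {f. v f = y}" for y
  have "cring P"
    unfolding P_def by (rule cring_from_type_algebra)
  moreover have UNIV: "carrier P = UNIV"
    by (simp add: P_def ring_of_type_algebra_def)
  ultimately have "ideal I P"
    unfolding I_def by (intro cring.cgenideal_ideal) auto
  then interpret ideal I P .
  have h: "h (v f) = I +>\<^bsub>P\<^esub> f" for f
    unfolding h_def v_def I_def P_def poly_ring_coset by (simp add: e_mult_eq_iff[OF Q])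
  have B: "carrier ?B = range (\<lambda>f. I +>\<^bsub>P\<^esub> f)"
      "\<one>\<^bsub>?B\<^esub> = I +>\<^bsub>P\<^esub> 1"
      "(I +>\<^bsub>P\<^esub> f) \<otimes>\<^bsub>?B\<^esub> (I +>\<^bsub>P\<^esub> g) = I +>\<^bsub>P\<^esub> (f * g)"
      "(I +>\<^bsub>P\<^esub> f) \<oplus>\<^bsub>?B\<^esub> (I +>\<^bsub>P\<^esub> g) = I +>\<^bsub>P\<^esub> (f + g)"
      "c \<odot>\<^bsub>?B\<^esub> (I +>\<^bsub>P\<^esub> f) = I +>\<^bsub>P\<^esub> ([:c:] * f)" for f g c
    using rcoset_mult_add[of f g] a_rcos_sum[of f g] rcoset_mult_add[of "[:c:]" f]
    by (auto simp: poly_quotient_algebra_def Let_def FactRing_def A_RCOSETS_def' UNIV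
        simp flip: P_def I_def) (simp_all add: P_def ring_of_type_algebra_def)
  \<comment> \<open>\<open>v\<close> is multiplicative and sends \<open>1\<close> to the unit
    \<open>e Q\<close> of the component because \<open>e Q\<close> takes only the values 0 and
    1.\<close>
  have v_simps: "v f ** v g = v (f * g)" "v f + v g = v (f + g)" "mat c ** v f = v ([:c:] * f)"
    "e Q = v 1" for f g c
    using Q unfolding v_def e_def poly_mat_mult poly_mat_add poly_mat_smult poly_mat_eq_iff
    by (auto simp: ac_eval_idem_poly algebra_simps)
  have C_carrier: "carrier ?C = range v"
    by (auto simp: component_algebra_def spectral_algebra_def v_def)
  have C: "\<one>\<^bsub>?C\<^esub> = v 1" "v f \<otimes>\<^bsub>?C\<^esub> v g = v (f * g)"
      "v f \<oplus>\<^bsub>?C\<^esub> v g = v (f + g)" "c \<odot>\<^bsub>?C\<^esub> v f = v ([:c:] * f)" for f g c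
    by (simp_all add: component_algebra_def spectral_algebra_def v_simps)
  have "h \<in> ring_hom ?C ?B"
    by (rule ring_hom_memI) (auto simp: C_carrier C B h)
  moreover have "bij_betw h (carrier ?C) (carrier ?B)"
  proof (rule bij_betw_imageI)
    show "inj_on h (carrier ?C)"
      unfolding C_carrier by (rule inj_onI) (auto simp: h_def)
    show "h ` carrier ?C = carrier ?B"
      unfolding C_carrier B by (simp add: image_image h)
  qed
  moreover have "h (c \<odot>\<^bsub>?C\<^esub> y) = c \<odot>\<^bsub>?B\<^esub> h y" if "y \<in> carrier ?C" for c y
    using that by (auto simp: C_carrier C B h)
  ultimately show ?thesis
    unfolding algebra_isomorphic_def ring_iso_def by blast
qed

end

theorem proposition8p1:
  fixes S :: "'g::{finite, ab_group_add} set"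
  assumes "0 \<notin> S"
    and "uminus ` S = S"
    and "\<not> CHAR('k::field) dvd CARD('g)"
  shows
    "(\<forall>Q \<in> (cay_orbits S :: 'k alg_closure set set).
        (\<exists>u. [cay_cofactor S Q * u = 1] (mod orbit_poly Q)) \<and>
        [cay_cofactor S Q * euclid_inverse (cay_cofactor S Q) (orbit_poly Q) = 1]
          (mod orbit_poly Q)) \<and>
     (\<forall>u :: 'k alg_closure set \<Rightarrow> 'k poly.
        (\<forall>Q \<in> cay_orbits S. [cay_cofactor S Q * u Q = 1] (mod orbit_poly Q)) \<longrightarrow>
        (let A = cay_adj S :: 'k ^ ('g::_) ^ ('g::_);
             R = spectral_algebra A;
             e = (\<lambda>Q. poly_mat (cay_cofactor S Q) A ** poly_mat (u Q) A)
         in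
           (\<forall>Q \<in> cay_orbits S. primitive_idempotent R (e Q)) \<and>
           (\<forall>Q \<in> cay_orbits S. e Q ** e Q = e Q) \<and>
           (\<forall>Q \<in> cay_orbits S. \<forall>Q' \<in> cay_orbits S. Q \<noteq> Q' \<longrightarrow> e Q ** e Q' = 0) \<and>
           (\<Sum>Q \<in> cay_orbits S. e Q) = mat 1 \<and>
           (\<forall>Q \<in> cay_orbits S. \<forall>f.
              primitive_idempotent R f \<and>
              (\<forall>Q' \<in> cay_orbits S - {Q}. f ** e Q' = 0) \<and>
              f + (\<Sum>Q' \<in> cay_orbits S - {Q}. e Q') = mat 1
              \<longleftrightarrow> f = e Q) \<and>
           (\<forall>Q \<in> cay_orbits S.
              algebra_isomorphic ring_of_type_algebra
                (component_algebra R (e Q)) (poly_quotient_algebra (orbit_poly Q)))))"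
proof -
  interpret cayley_spectrum S "TYPE('k)"
    by standard (fact assms(3))
  have inverse: "\<forall>Q\<in>orbits. (\<exists>u. [cay_cofactor S Q * u = 1] (mod orbit_poly Q)) \<and>
      [cay_cofactor S Q * euclid_inverse (cay_cofactor S Q) (orbit_poly Q) = 1] (mod orbit_poly Q)"
    using euclid_inverse_cofactor_cong by blast
  show ?thesis
  proof (intro conjI[OF inverse] allI impI)
    fix u :: "'k alg_closure set \<Rightarrow> 'k poly"
    assume u: "\<forall>Q\<in>orbits. [cay_cofactor S Q * u Q = 1] (mod orbit_poly Q)"
    interpret cayley_idempotents S "TYPE('k)" u
      by standard (use u in blast)
    \<comment> \<open>For the forward direction, \<open>f\<close> and \<open>e Q\<close> have the
      same sum with the remaining idempotents, which is then cancelled.\<close>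
    have unique: "primitive_idempotent (spectral_algebra A) f \<and>
        (\<forall>Q'\<in>orbits - {Q}. f ** e Q' = 0) \<and> f + (\<Sum>Q'\<in>orbits - {Q}. e Q') = mat 1 \<longleftrightarrow> f = e Q"
      if Q: "Q \<in> orbits" for Q f
      using e_primitive[OF Q] e_orth[OF Q] e_add_sum[OF Q]
      by (metis (no_types, lifting) DiffE add_right_cancel singletonI)
    show "let A = cay_adj S :: 'k ^ ('g::_) ^ ('g::_);
             R = spectral_algebra A;
             e = (\<lambda>Q. poly_mat (cay_cofactor S Q) A ** poly_mat (u Q) A)
         in
           (\<forall>Q \<in> cay_orbits S. primitive_idempotent R (e Q)) \<and>
           (\<forall>Q \<in> cay_orbits S. e Q ** e Q = e Q) \<and>
           (\<forall>Q \<in> cay_orbits S. \<forall>Q' \<in> cay_orbits S. Q \<noteq> Q' \<longrightarrow> e Q ** e Q' = 0) \<and>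
           (\<Sum>Q \<in> cay_orbits S. e Q) = mat 1 \<and>
           (\<forall>Q \<in> cay_orbits S. \<forall>f.
              primitive_idempotent R f \<and>
              (\<forall>Q' \<in> cay_orbits S - {Q}. f ** e Q' = 0) \<and>
              f + (\<Sum>Q' \<in> cay_orbits S - {Q}. e Q') = mat 1
              \<longleftrightarrow> f = e Q) \<and>
           (\<forall>Q \<in> cay_orbits S.
              algebra_isomorphic ring_of_type_algebra
                (component_algebra R (e Q)) (poly_quotient_algebra (orbit_poly Q)))"
      unfolding Let_def e_altdef
      by (intro conjI ballI allI impI unique e_sum;
          simp add: e_primitive e_idem e_orth e_component_iso)
  qed
qed

end
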